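(* For complex $q$ with $|q|<1$ let $$P(q) := \frac{E(q^2)E(q^3)E(q^8)E(q^{12})}{E(q)E(q^{24})}, \qquad Q(q) := q \frac{E(q)E(q^4)E(q^6)E(q^{24})}{E(q^3)E(q^8)}.$$ Then $$P(q) = \sum_{n=-\infty}^{\infty} \frac{q^n + q^{5n}}{1 + q^{12n}} = 1 + \sum_{n=1}^{\infty} \left(\frac{-6}{n}\right) \frac{q^n}{1 - q^n},$$ $$Q(q) = \sum_{n=-\infty}^{\infty} \frac{q^{3n+1} - q^{9n+3}}{1 + q^{12n+4}} = \sum_{n=1}^{\infty} \left(\frac{n}{3}\right) \frac{q^n(1 - q^{2n})}{1 + q^{4n}}.$$ Moreover, $$\varphi(q)\varphi(q^6) = P(q) + Q(q) = 2 \left\{ \sum_{n=-\infty}^{\infty} \frac{q^n}{1 + q^{12n}} - \sum_{n=-\infty}^{\infty} \frac{q^{9n+3}}{1 + q^{12n+4}} \right\} = 2 \left\{ \sum_{n=-\infty}^{\infty} \frac{q^{5n}}{1 + q^{12n}} + \sum_{n=-\infty}^{\infty} \frac{q^{3n+1}}{1 + q^{12n+4}} \right\},$$ and $$\varphi(q^2)\varphi(q^3) = P(q) - Q(q) = 2 \left\{ \sum_{n=-\infty}^{\infty} \frac{q^n}{1 + q^{12n}} - \sum_{n=-\infty}^{\infty} \frac{q^{3n+1}}{1 + q^{12n+4}} \right\} = 2 \left\{ \sum_{n=-\infty}^{\infty} \frac{q^{5n}}{1 + q^{12n}} + \sum_{n=-\infty}^{\infty} \frac{q^{9n+3}}{1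 + q^{12n+4}} \right\}.$$
   Context: For $|q|<1$: $E(q):=\prod_{n\ge 1}(1-q^n)$ and $\varphi(q):=\sum_{n=-\infty}^{\infty} q^{n^2}$. $\left(\frac{-6}{n}\right)$ denotes the Kronecker symbol and $\left(\frac{n}{3}\right)$ the Legendre symbol modulo 3 (zero when $3\mid n$). *)

theory Defs
  imports "HOL-Analysis.Analysis" "HOL-Number_Theory.Number_Theory"
begin

definition euler_E :: "complex \<Rightarrow> complex" where
  "euler_E q = prodinf (\<lambda>n::nat. 1 - q ^ Suc n)"

definition theta_phi :: "complex \<Rightarrow> complex" where
  "theta_phi q = (\<Sum>\<^sub>\<infinity>n\<in>(UNIV::int set). q powi (n\<^sup>2))"

text \<open>
  The local factor of the Kronecker symbol at a prime. The prime 2 is treated separately,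
  since \<^const>\<open>Legendre\<close> has the value 1 at every odd \<open>a\<close> when the modulus is 2.
\<close>

definition kronecker_prime :: "int \<Rightarrow> int \<Rightarrow> int" where
  "kronecker_prime a p =
     (if p = 2 then (if even a then 0 else if a mod 8 \<in> {1, 7} then 1 else -1)
      else Legendre a p)"

definition kronecker :: "int \<Rightarrow> int \<Rightarrow> int" where
  "kronecker a n =
     (if n = 0 then (if \<bar>a\<bar> = 1 then 1 else 0)
      else (if n < 0 \<and> a < 0 then -1 else 1) *
           (\<Prod>p\<in>prime_factors n. kronecker_prime a p ^ multiplicity p n))"

definition P_quot :: "complex \<Rightarrow> complex" where
  "P_quot q =
     euler_E (q^2) * euler_E (q^3) * euler_E (q^8) * euler_E (q^12) /
     (euler_E q * euler_E (q^24))"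

definition Q_quot :: "complex \<Rightarrow> complex" where
  "Q_quot q =
     q * (euler_E q * euler_E (q^4) * euler_E (q^6) * euler_E (q^24) /
          (euler_E (q^3) * euler_E (q^8)))"

text \<open>
  In a bilateral series whose terms are rational functions in powers \<open>q powi k\<close>, such as
  \<open>q powi n / (1 + q powi (12 * n))\<close>, the terms with negative exponents are literally undefined
  at \<open>q = 0\<close>. They are read with \<open>0 powi k = 0\<close> for \<open>k < 0\<close>; for all series that occur, this
  gives the limit of each term as \<open>q\<close> tends to 0.
\<close>

end

(* The six bilateral series are specialisations of the Kronecker identity
     theta(a) theta(x) sum x^n / (1 - a p^n) = E(p)^3 theta(a x)   (p = q^12),
   which holds because the Laurent coefficients of theta(x) sum x^n / (1 - a p^n) satisfy the same
   first-order recurrence as those of theta(a x); the constant is found by letting x tend to 1.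
   Write A, B for the sums of q^n / (1 + q^(12n)), q^(5n) / (1 + q^(12n)) and C, D for those of
   q^(3n+1) / (1 + q^(12n+4)), q^(9n+3) / (1 + q^(12n+4)).  The two-variable addition formulas give
   A + B = P and an eta quotient for A - B, the pentagonal number theorem gives C - D = Q and the
   same eta quotient for C + D, and one instance of the three-term relation for theta functions
   turns 2 (A - D) into phi(q) phi(q^6) = P + Q.  The value P - Q of phi(q^2) phi(q^3) then follows
   by extracting the even powers of q. *)

theory Submission
  imports Defs
begin

section \<open>Bilateral sums and the theta series\<close>

text \<open>The instances of Kronecker's identity have (a, x) = (-1, q), (-1, q^5), (-q^4, q^3),
  (-q^4, q^9). After reflection the only numerators theta(a x) are theta(-q) and theta(-q^5); C and
  D have one common denominator, while those of A and B differ only in theta(q) against theta(q^5).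
  A and D share no such structure, which is why A - D needs a relation between three products of
  four theta values. All remaining formulas are linear: from A + B = P, C - D = Q and A - B = C + D
  follow P + Q = 2 (A - D) = 2 (B + C) and P - Q = 2 (A - C) = 2 (B + D). The coefficient recurrence
  leaves a constant open, and at x = 1 theta vanishes while the series has a pole. This is what
  calls for the triple product, which exhibits the factor 1 - x, and for a dominated limit. The
  point q = 0 is treated apart, because the theta identities divide by powers of q.\<close>

lemma int_abs_summableI:
  fixes f :: "int \<Rightarrow> 'a :: banach"
  assumes "summable (\<lambda>n. norm (f (int n)))" "summable (\<lambda>n. norm (f (- int n)))"
  shows "(\<lambda>k. norm (f k)) summable_on UNIV"
proof -
  have 1: "(\<lambda>k. norm (f k)) summable_on (range int)"
    using assms(1) by (subst summable_on_reindex) (auto simp: o_def summable_on_UNIV_nonneg_real_iff)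
  have 2: "(\<lambda>k. norm (f k)) summable_on (range (\<lambda>n. - int n))"
    using assms(2) by (subst summable_on_reindex) (auto simp: o_def inj_on_def summable_on_UNIV_nonneg_real_iff)
  have "range int \<union> range (\<lambda>n. - int n) = UNIV"
    by (auto simp: image_iff) (metis int_cases2)
  then show ?thesis
    using summable_on_union[OF 1 2] by simp
qed

lemma abs_summable_on_product:
  fixes f :: "'a \<Rightarrow> 'c :: {real_normed_div_algebra, banach}"
  assumes "(\<lambda>x. norm (f x)) summable_on A" "(\<lambda>x. norm (g x)) summable_on B"
  shows "(\<lambda>z. norm (case z of (x, y) \<Rightarrow> f x * g y)) summable_on A \<times> B"
  unfolding Infinite_Sum.abs_summable_on_Sigma_iff
  using assms
  by (auto simp: norm_mult infsum_cmult_right' abs_mult infsum_nonneg abs_of_nonneg intro!: summable_on_cmult_right summable_on_cmult_left)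

lemma infsum_mult_product:
  fixes f :: "'a \<Rightarrow> 'c :: {real_normed_field, banach}"
  assumes "(\<lambda>x. norm (f x)) summable_on A" "(\<lambda>x. norm (g x)) summable_on B"
  shows "infsum f A * infsum g B = (\<Sum>\<^sub>\<infinity>(x, y)\<in>A \<times> B. f x * g y)"
proof -
  have "(\<Sum>\<^sub>\<infinity>(x, y)\<in>A \<times> B. f x * g y) = (\<Sum>\<^sub>\<infinity>x\<in>A. \<Sum>\<^sub>\<infinity>y\<in>B. f x * g y)"
    using abs_summable_on_product[OF assms]
    by (subst infsum_Sigma_banach[symmetric]) (auto intro: abs_summable_summable)
  then show ?thesis
    by (simp add: infsum_cmult_right' infsum_cmult_left')
qed

text \<open>Dominated convergence over the integers: enumerating them by \<open>int_decode\<close>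
  reduces it to Tannery's theorem for ordinary series. It serves twice, for the limit of the finite
  triple product and for x tending to 1 in Kronecker's series.\<close>

lemma tendsto_infsum_int:
  fixes f :: "'b \<Rightarrow> int \<Rightarrow> 'a :: {real_normed_algebra, banach}"
  assumes lim: "\<And>k. ((\<lambda>x. f x k) \<longlongrightarrow> g k) F"
    and bd: "eventually (\<lambda>x. \<forall>k. norm (f x k) \<le> M k) F"
    and M: "M summable_on UNIV" and [simp]: "F \<noteq> bot"
  shows "((\<lambda>x. infsum (f x) UNIV) \<longlongrightarrow> infsum g UNIV) F"
proof -
  have Mnn: "M k \<ge> 0" for k
  proof -
    obtain x where "norm (f x k) \<le> M k"
      using eventually_happens'[OF \<open>F \<noteq> bot\<close> bd] by blast
    then show ?thesis using norm_ge_zero order_trans by blast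
  qed
  have bij: "bij int_decode" by (simp add: bij_int_decode)
  have sm: "summable (\<lambda>n. M (int_decode n))"
    using M Mnn by (subst summable_on_UNIV_nonneg_real_iff[symmetric])
      (auto simp: summable_on_reindex_bij_betw[OF bij])
  have eq: "infsum h UNIV = (\<Sum>n. h (int_decode n))" if "\<And>k. norm (h k) \<le> M k" for h :: "int \<Rightarrow> 'a"
  proof -
    have "summable (\<lambda>n. norm (h (int_decode n)))"
      by (rule summable_comparison_test[OF _ sm]) (use that in auto)
    then have "((\<lambda>n. h (int_decode n)) has_sum (\<Sum>n. h (int_decode n))) UNIV"
      by (intro norm_summable_imp_has_sum) (auto intro: summable_sums summable_norm_cancel)
    then show ?thesis
      by (metis infsumI infsum_reindex_bij_betw[OF bij])
  qed
  have gM: "norm (g k) \<le> M k" for k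
    by (rule tendsto_upperbound[OF tendsto_norm[OF lim]]) (use bd in \<open>auto elim: eventually_mono\<close>)
  have "((\<lambda>x. \<Sum>n. f x (int_decode n)) \<longlongrightarrow> (\<Sum>n. g (int_decode n))) F"
    by (rule tannerys_theorem[where M = "\<lambda>n. M (int_decode n)", THEN conjunct2, THEN conjunct2])
      (use lim sm bd in \<open>auto simp: eventually_prod_filter intro!: exI[of _ "\<lambda>_::nat. True"]
         exI[of _ "\<lambda>x. \<forall>k. norm (f x k) \<le> M k"]\<close>)
  then show ?thesis
    by (subst eq[OF gM], rule Lim_transform_eventually)
       (use bd in \<open>auto elim!: eventually_mono simp: eq\<close>)
qed

section \<open>Triangular exponents and convergence of the theta series\<close>

definition tri :: "int \<Rightarrow> int" where "tri k = k * (k - 1) div 2"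

lemma two_tri: "2 * tri k = k * (k - 1)"
  unfolding tri_def by (intro dvd_mult_div_cancel) auto

lemma tri_eqI: "2 * m = k * (k - 1) \<Longrightarrow> tri k = m"
  using two_tri[of k] by simp

lemma tri_plus_one: "tri (k + 1) = tri k + k"
  by (rule tri_eqI) (use two_tri[of k] in \<open>simp add: algebra_simps\<close>)

lemma tri_one_minus: "tri (1 - k) = tri k"
  by (rule tri_eqI) (use two_tri[of k] in \<open>simp add: algebra_simps\<close>)

lemma tri_0 [simp]: "tri 0 = 0" and tri_1 [simp]: "tri 1 = 0"
  by (simp_all add: tri_def)

definition theta_term :: "complex \<Rightarrow> complex \<Rightarrow> int \<Rightarrow> complex" where
  "theta_term p z k = p powi tri k * (- z) powi k"

text \<open>The normalisation is that of the triple product (p;p)(z;p)(p/z;p), so that the zeros lie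
  at the integral powers of \<open>p\<close>.\<close>

definition theta :: "complex \<Rightarrow> complex \<Rightarrow> complex" where
  "theta p z = (\<Sum>\<^sub>\<infinity>k. theta_term p z k)"

text \<open>The ratio of consecutive terms is \<open>r ^ n * s\<close>, which tends to 0 however
  large \<open>s\<close> is. The terms of theta with negative index have the same shape, with |p| /
  |z| in place of |z|.\<close>

lemma summable_theta_nat:
  fixes r s :: real
  assumes "0 < r" "r < 1" "0 < s"
  shows "summable (\<lambda>n. r powi tri (int n) * s ^ n)"
proof -
  have "(\<lambda>n. r ^ n * s) \<longlonglongrightarrow> 0 * s"
    using assms by (intro tendsto_intros LIMSEQ_realpow_zero) auto
  then have "eventually (\<lambda>n. r ^ n * s < 1 / 2) sequentially"
    by (rule order_tendstoD) auto
  then obtain N where N: "\<And>n. n \<ge> N \<Longrightarrow> r ^ n * s < 1 / 2"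
    by (auto simp: eventually_sequentially)
  have "norm (r powi tri (int (Suc n)) * s ^ Suc n) \<le> 1 / 2 * norm (r powi tri (int n) * s ^ n)"
    if "n \<ge> N" for n
  proof -
    have "r powi tri (int (Suc n)) * s ^ Suc n = (r ^ n * s) * (r powi tri (int n) * s ^ n)"
      using assms tri_plus_one[of "int n"] by (simp add: power_int_add add.commute)
    also have "\<dots> \<le> 1 / 2 * (r powi tri (int n) * s ^ n)"
      using N[OF that] assms by (intro mult_right_mono) auto
    finally show ?thesis using assms by simp
  qed
  then show ?thesis
    by (intro summable_ratio_test[of "1 / 2" N]) auto
qed

lemma theta_summable:
  assumes "p \<noteq> 0" "norm p < 1" "z \<noteq> 0"
  shows "(\<lambda>k. norm (theta_term p z k)) summable_on UNIV"
proof (rule int_abs_summableI)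
  show "summable (\<lambda>n. norm (theta_term p z (int n)))"
    using summable_theta_nat[of "norm p" "norm z"] assms
    by (simp add: theta_term_def norm_mult norm_power norm_power_int)
  have "tri (- int n) = tri (int n) + int n" for n
    by (rule tri_eqI) (use two_tri[of "int n"] in \<open>simp add: algebra_simps\<close>)
  then show "summable (\<lambda>n. norm (theta_term p z (- int n)))"
    using summable_theta_nat[of "norm p" "norm p / norm z"] assms
    by (simp add: theta_term_def norm_mult norm_power norm_power_int power_int_add power_int_minus
        norm_divide divide_simps)
qed

section \<open>Functional equations and addition formulas for the theta series\<close>

lemma infsum_int_shift:
  fixes f :: "int \<Rightarrow> 'a :: {comm_monoid_add, t2_space}"
  shows "(\<Sum>\<^sub>\<infinity>k. f (k + c)) = infsum f UNIV"
  by (rule infsum_reindex_bij_witness[of _ "\<lambda>k. k - c" "\<lambda>k. k + c"]) auto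

lemma infsum_int_uminus:
  fixes f :: "int \<Rightarrow> 'a :: {comm_monoid_add, t2_space}"
  shows "(\<Sum>\<^sub>\<infinity>k. f (- k)) = infsum f UNIV"
  by (rule infsum_reindex_bij_witness[of _ uminus uminus]) auto

lemma theta_mult_nome:
  assumes "p \<noteq> 0" "z \<noteq> 0"
  shows "theta p (p * z) = - theta p z / z"
proof -
  have "theta_term p (p * z) k = (- 1 / z) * theta_term p z (k + 1)" for k
  proof -
    have "(- (p * z)) powi k = p powi k * (- z) powi k"
      by (metis mult_minus_right power_int_mult_distrib)
    then show ?thesis
      using assms by (simp add: theta_term_def tri_plus_one power_int_add)
  qed
  then have "theta p (p * z) = (\<Sum>\<^sub>\<infinity>k. (- 1 / z) * theta_term p z (k + 1))"
    unfolding theta_def by (rule infsum_cong)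
  also have "\<dots> = (- 1 / z) * theta p z"
    by (simp only: infsum_cmult_right' infsum_int_shift theta_def)
  finally show ?thesis by simp
qed

lemma theta_nome_divide:
  assumes "p \<noteq> 0" "z \<noteq> 0"
  shows "theta p (p / z) = theta p z"
proof -
  have t: "tri (- k) = tri k + k" for k
    using tri_one_minus[of "k + 1"] tri_plus_one[of k] by simp
  have "theta_term p (p / z) k = theta_term p z (- k)" for k
  proof -
    have "(- (p / z)) powi k = p powi k * (- z) powi (- k)"
      by (metis divide_minus_right divide_inverse power_int_divide_distrib power_int_minus)
    then show ?thesis
      using assms t[of k] by (simp add: theta_term_def power_int_add)
  qed
  then show ?thesis
    by (simp add: theta_def infsum_int_uminus)
qed

lemma theta_inverse:
  assumes "p \<noteq> 0" "z \<noteq> 0"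
  shows "theta p (1 / z) = - theta p z / z"
proof -
  have "theta p (p * (1 / z)) = - theta p (1 / z) / (1 / z)"
    using assms by (intro theta_mult_nome) auto
  then show ?thesis using theta_nome_divide[OF assms] assms by (simp add: field_simps)
qed

text \<open>Inversion gives theta = - theta at its fixed point 1. This zero makes the recurrence of
  \<open>kron_S\<close> homogeneous.\<close>

lemma theta_one: "p \<noteq> 0 \<Longrightarrow> theta p 1 = 0"
  using theta_inverse[of p 1] by simp

lemma power_int_add_diff:
  fixes x y :: "'a :: field"
  assumes "x \<noteq> 0" "y \<noteq> 0"
  shows "x powi (r + s) * y powi (r - s) = (x * y) powi r * (x / y) powi s"
  using assms by (simp add: power_int_add power_int_diff power_int_mult_distrib power_int_divide_distrib)

lemma even_div2_add_diff:
  fixes a b :: int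
  assumes "odd a" "odd b"
  shows "(a + b) div 2 + (a - b) div 2 = a"
  using assms by (elim oddE) simp

lemma odd_div2_add_diff:
  fixes a b :: int
  assumes "odd (a + b)"
  shows "(a + b) div 2 + (a - b) div 2 + 1 = a"
proof -
  obtain c where "a + b = 2 * c + 1" using assms by (rule oddE)
  then have "a - b = 2 * (c - b) + 1" by simp
  with \<open>a + b = 2 * c + 1\<close> show ?thesis by simp
qed

text \<open>The coordinates r + s, r - s diagonalise the exponent: tri (r + s) + tri (r - s) = r (r
  - 1) + s^2 has no mixed term, so the product separates into terms of nome p^2.\<close>

lemma theta_term_even:
  assumes "p \<noteq> 0" "a \<noteq> 0" "b \<noteq> 0"
  shows "theta_term p a (r + s) * theta_term p b (r - s) =
    theta_term (p\<^sup>2) (- (a * b)) r * theta_term (p\<^sup>2) (- (p * a / b)) s"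
proof -
  have "tri (r + s) + tri (r - s) = 2 * tri r + (2 * tri s + s)"
    using two_tri[of "r + s"] two_tri[of "r - s"] two_tri[of r] two_tri[of s]
    by (simp add: algebra_simps)
  then have "p powi tri (r + s) * p powi tri (r - s) = p powi (2 * tri r + (2 * tri s + s))"
    using assms by (simp flip: power_int_add)
  also have "\<dots> = (p\<^sup>2) powi tri r * ((p\<^sup>2) powi tri s * p powi s)"
    using assms by (simp add: power_int_add power_int_power)
  finally have 1: "p powi tri (r + s) * p powi tri (r - s) = (p\<^sup>2) powi tri r * ((p\<^sup>2) powi tri s * p powi s)" .
  have 2: "(- a) powi (r + s) * (- b) powi (r - s) = (a * b) powi r * (a / b) powi s"
    using power_int_add_diff[of "- a" "- b" r s] assms by simp
  have "theta_term p a (r + s) * theta_term p b (r - s) =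
      (p powi tri (r + s) * p powi tri (r - s)) * ((- a) powi (r + s) * (- b) powi (r - s))"
    by (simp add: theta_term_def)
  also have "\<dots> = (p\<^sup>2) powi tri r * (a * b) powi r * ((p\<^sup>2) powi tri s * (p * (a / b)) powi s)"
    unfolding 1 2 power_int_mult_distrib by (simp only: mult_ac)
  finally show ?thesis by (simp add: theta_term_def)
qed

text \<open>Indices of different parity need the offset 1; the exponent is then r^2 + s (s + 1),
  again without a mixed term.\<close>

lemma theta_term_odd:
  assumes "p \<noteq> 0" "a \<noteq> 0" "b \<noteq> 0"
  shows "theta_term p a (r + s + 1) * theta_term p b (r - s) =
    - a * (theta_term (p\<^sup>2) (- (p * a * b)) r * theta_term (p\<^sup>2) (- (p\<^sup>2 * a / b)) s)"
proof -
  have "tri (r + s + 1) + tri (r - s) = (2 * tri r + r) + (2 * tri s + 2 * s)"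
    using two_tri[of "r + s + 1"] two_tri[of "r - s"] two_tri[of r] two_tri[of s]
    by (simp add: algebra_simps)
  then have "p powi tri (r + s + 1) * p powi tri (r - s) = p powi ((2 * tri r + r) + (2 * tri s + 2 * s))"
    using assms by (simp flip: power_int_add)
  also have "\<dots> = (p\<^sup>2) powi tri r * p powi r * ((p\<^sup>2) powi tri s * (p\<^sup>2) powi s)"
    using assms by (simp add: power_int_add power_int_power)
  finally have 1: "p powi tri (r + s + 1) * p powi tri (r - s) =
    (p\<^sup>2) powi tri r * p powi r * ((p\<^sup>2) powi tri s * (p\<^sup>2) powi s)" .
  have 2: "(- a) powi (r + s + 1) * (- b) powi (r - s) = (- a) * ((a * b) powi r * (a / b) powi s)"
    using power_int_add_diff[of "- a" "- b" r s] assms by (simp add: power_int_add mult.assoc)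
  have "theta_term p a (r + s + 1) * theta_term p b (r - s) =
      (p powi tri (r + s + 1) * p powi tri (r - s)) * ((- a) powi (r + s + 1) * (- b) powi (r - s))"
    by (simp add: theta_term_def)
  also have "\<dots> = - a * ((p\<^sup>2) powi tri r * (p * (a * b)) powi r * ((p\<^sup>2) powi tri s * (p\<^sup>2 * (a / b)) powi s))"
    unfolding 1 2 power_int_mult_distrib by (simp only: mult_ac)
  finally show ?thesis by (simp add: theta_term_def mult.assoc)
qed

text \<open>The double series is split according to the parity of the sum of its two indices.\<close>

lemma theta_mult_theta:
  assumes p: "p \<noteq> 0" "norm p < 1" and a: "a \<noteq> 0" and b: "b \<noteq> 0"
  shows "theta p a * theta p b =
    theta (p\<^sup>2) (- (a * b)) * theta (p\<^sup>2) (- (p * a / b)) -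
    a * theta (p\<^sup>2) (- (p * a * b)) * theta (p\<^sup>2) (- (p\<^sup>2 * a / b))"
proof -
  define F where "F = (\<lambda>(k, l). theta_term p a k * theta_term p b l)"
  define S where "S e = {z :: int \<times> int. even (fst z + snd z) = e}" for e
  have p2: "p\<^sup>2 \<noteq> 0" "norm (p\<^sup>2) < 1"
    using p by (auto simp: norm_power power_less_one_iff)
  have sF: "(\<lambda>z. norm (F z)) summable_on UNIV"
    using abs_summable_on_product[OF theta_summable[OF p a] theta_summable[OF p b]]
    by (simp add: F_def)
  have sFS: "F summable_on S e" for e
    by (rule summable_on_subset_banach[OF abs_summable_summable[OF sF]]) auto
  have prod: "(\<Sum>\<^sub>\<infinity>(r, s). theta_term (p\<^sup>2) x r * theta_term (p\<^sup>2) y s) = theta (p\<^sup>2) x * theta (p\<^sup>2) y"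
    if "x \<noteq> 0" "y \<noteq> 0" for x y
    unfolding theta_def using infsum_mult_product[OF theta_summable theta_summable] p2 that by simp
  have "theta p a * theta p b = infsum F (S True \<union> S False)"
    unfolding theta_def F_def S_def
    by (subst infsum_mult_product[OF theta_summable[OF p a] theta_summable[OF p b]])
       (auto intro: arg_cong[where f = "infsum _"])
  also have "\<dots> = infsum F (S True) + infsum F (S False)"
    by (rule infsum_Un_disjoint) (auto simp: sFS, auto simp: S_def)
  also have "infsum F (S True) =
      (\<Sum>\<^sub>\<infinity>(r, s). theta_term (p\<^sup>2) (- (a * b)) r * theta_term (p\<^sup>2) (- (p * a / b)) s)"
    by (rule infsum_reindex_bij_witness[symmetric, where j = "\<lambda>(r, s). (r + s, r - s)"
          and i = "\<lambda>(k, l). ((k + l) div 2, (k - l) div 2)"])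
       (auto simp: S_def F_def theta_term_even p a b even_div2_add_diff)
  also have "\<dots> = theta (p\<^sup>2) (- (a * b)) * theta (p\<^sup>2) (- (p * a / b))"
    using p a b by (intro prod) auto
  also have "infsum F (S False) =
      (\<Sum>\<^sub>\<infinity>(r, s). - a * (theta_term (p\<^sup>2) (- (p * a * b)) r * theta_term (p\<^sup>2) (- (p\<^sup>2 * a / b)) s))"
    by (rule infsum_reindex_bij_witness[symmetric, where j = "\<lambda>(r, s). (r + s + 1, r - s)"
          and i = "\<lambda>(k, l). ((k + l) div 2, (k - l) div 2)"])
       (auto simp: S_def F_def theta_term_odd p a b odd_div2_add_diff)
  also have "\<dots> = - a * (\<Sum>\<^sub>\<infinity>(r, s). theta_term (p\<^sup>2) (- (p * a * b)) r * theta_term (p\<^sup>2) (- (p\<^sup>2 * a / b)) s)"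
    by (simp only: case_prod_unfold infsum_cmult_right')
  also have "\<dots> = - a * (theta (p\<^sup>2) (- (p * a * b)) * theta (p\<^sup>2) (- (p\<^sup>2 * a / b)))"
    by (subst prod) (use p a b in auto)
  finally show ?thesis by simp
qed

text \<open>Moving the minus sign from one factor to the other keeps the product and the quotient of
  the two arguments. Only the prefactor of the second summand in \<open>theta_mult_theta\<close>
  changes its sign, so sum and difference isolate one summand each.\<close>

lemma theta_mult_sum:
  assumes "p \<noteq> 0" "norm p < 1" "a \<noteq> 0" "b \<noteq> 0"
  shows "theta p (- a) * theta p b + theta p a * theta p (- b) =
    2 * theta (p\<^sup>2) (a * b) * theta (p\<^sup>2) (p * a / b)"
  using theta_mult_theta[of p "- a" b] theta_mult_theta[of p a "- b"] assms by simp

lemma theta_mult_diff: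
  assumes "p \<noteq> 0" "norm p < 1" "a \<noteq> 0" "b \<noteq> 0"
  shows "theta p (- a) * theta p b - theta p a * theta p (- b) =
    2 * a * theta (p\<^sup>2) (p * a * b) * theta (p\<^sup>2) (p\<^sup>2 * a / b)"
  using theta_mult_theta[of p "- a" b] theta_mult_theta[of p a "- b"] assms by simp

text \<open>For arguments xy and x/y, the product is x^2 and the quotient y^2, which separates the
  variables. The vector attached to \<open>x\<close> is
  (\<open>theta (p\<^sup>2) (- (x\<^sup>2))\<close>,
  \<open>x * theta (p\<^sup>2) (- (p * x\<^sup>2))\<close>); the factor \<open>y\<close> on the left
  makes the vector attached to \<open>y\<close> have the same form.\<close>

lemma theta_mult_det:
  assumes "p \<noteq> 0" "norm p < 1" "x \<noteq> 0" "y \<noteq> 0"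
  shows "y * (theta p (x * y) * theta p (x / y)) =
    theta (p\<^sup>2) (- (x\<^sup>2)) * (y * theta (p\<^sup>2) (- (p * y\<^sup>2))) -
    x * theta (p\<^sup>2) (- (p * x\<^sup>2)) * theta (p\<^sup>2) (- (y\<^sup>2))"
proof -
  have "theta (p\<^sup>2) (p\<^sup>2 * - (y\<^sup>2)) = - theta (p\<^sup>2) (- (y\<^sup>2)) / - (y\<^sup>2)"
    using assms by (intro theta_mult_nome) auto
  then have *: "theta (p\<^sup>2) (- (p\<^sup>2 * y\<^sup>2)) = theta (p\<^sup>2) (- (y\<^sup>2)) / y\<^sup>2"
    by simp
  have e: "(x * y) * (x / y) = x\<^sup>2" "p * (x * y) / (x / y) = p * y\<^sup>2"
    "p * (x * y) * (x / y) = p * x\<^sup>2" "p\<^sup>2 * (x * y) / (x / y) = p\<^sup>2 * y\<^sup>2"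
    using assms by (simp_all add: field_simps power2_eq_square)
  have "theta p (x * y) * theta p (x / y) =
      theta (p\<^sup>2) (- (x\<^sup>2)) * theta (p\<^sup>2) (- (p * y\<^sup>2)) -
      x * y * theta (p\<^sup>2) (- (p * x\<^sup>2)) * (theta (p\<^sup>2) (- (y\<^sup>2)) / y\<^sup>2)"
    using theta_mult_theta[of p "x * y" "x / y"] assms unfolding e * by simp
  then show ?thesis
    using assms by (simp add: field_simps power2_eq_square)
qed

text \<open>
  By the previous lemma each product of two theta functions is a 2 by 2 determinant, so that the
  three-term relation is the Pluecker relation between four vectors in the plane.
\<close>

lemma theta_three_term:
  assumes "p \<noteq> 0" "norm p < 1" "x \<noteq> 0" "y \<noteq> 0" "u \<noteq> 0" "v \<noteq> 0"
  shows "theta p (x * y) * theta p (x / y) * (theta p (u * v) * theta p (u / v)) -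
     theta p (x * v) * theta p (x / v) * (theta p (u * y) * theta p (u / y)) =
     u / y * (theta p (y * v) * theta p (y / v) * (theta p (x * u) * theta p (x / u)))"
proof -
  define D where "D x y = y * (theta p (x * y) * theta p (x / y))" for x y
  have "D x y * D u v - D x v * D u y = D y v * D x u"
    unfolding D_def
      theta_mult_det[OF assms(1,2,3,4)] theta_mult_det[OF assms(1,2,5,6)] theta_mult_det[OF assms(1,2,3,6)]
      theta_mult_det[OF assms(1,2,5,4)] theta_mult_det[OF assms(1,2,4,6)] theta_mult_det[OF assms(1,2,3,5)]
    by (simp add: algebra_simps)
  then have "(y * v) * (theta p (x * y) * theta p (x / y) * (theta p (u * v) * theta p (u / v)) -
     theta p (x * v) * theta p (x / v) * (theta p (u * y) * theta p (u / y))) =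
     (y * v) * (u / y * (theta p (y * v) * theta p (y / v) * (theta p (x * u) * theta p (x / u))))"
    using assms unfolding D_def by (simp add: algebra_simps)
  moreover have "y * v \<noteq> 0" using assms by simp
  ultimately show ?thesis
    by (rule mult_left_cancel[THEN iffD1, rotated])
qed

section \<open>Infinite products and the q-binomial theorem\<close>

definition qpoch :: "complex \<Rightarrow> complex \<Rightarrow> complex" where
  "qpoch a p = (\<Prod>n. 1 - a * p ^ n)"

lemma euler_E_eq_qpoch: "euler_E p = qpoch p p"
  by (simp add: euler_E_def qpoch_def)

lemma convergent_prod_qpoch:
  fixes p :: complex
  assumes "norm p < 1"
  shows "convergent_prod (\<lambda>n. 1 - a * p ^ n)"
proof -
  have "summable (\<lambda>n. norm a * norm p ^ n)"
    using assms by (intro summable_mult summable_geometric) auto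
  then have "summable (\<lambda>n. norm ((1 - a * p ^ n) - 1))"
    by (simp add: norm_mult norm_power)
  then show ?thesis
    by (intro abs_convergent_prod_imp_convergent_prod summable_imp_abs_convergent_prod)
qed

lemma qpoch_LIMSEQ:
  assumes "norm p < 1"
  shows "(\<lambda>n. \<Prod>k<n. 1 - a * p ^ k) \<longlonglongrightarrow> qpoch a p"
  using convergent_prod_LIMSEQ[OF convergent_prod_qpoch[OF assms, of a]]
  unfolding qpoch_def LIMSEQ_lessThan_iff_atMost[of "\<lambda>A. \<Prod>k\<in>A. 1 - a * p ^ k"]
  by simp

lemma qpoch_nonzero:
  assumes "norm p < 1" "\<And>n. a * p ^ n \<noteq> 1"
  shows "qpoch a p \<noteq> 0"
  unfolding qpoch_def using assms
  by (intro prodinf_nonzero convergent_prod_qpoch) auto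

lemma qpoch_nonzero_norm:
  assumes "norm p < 1" "norm a < 1"
  shows "qpoch a p \<noteq> 0"
proof (rule qpoch_nonzero[OF assms(1)])
  fix n
  have "norm (a * p ^ n) \<le> norm a * 1"
    unfolding norm_mult norm_power using assms by (intro mult_left_mono power_le_one) auto
  then show "a * p ^ n \<noteq> 1" using assms by (metis mult_1_right norm_one not_le)
qed

lemma qpoch_rec:
  assumes "norm p < 1"
  shows "qpoch a p = (1 - a) * qpoch (a * p) p"
proof (rule LIMSEQ_unique)
  show "(\<lambda>n. \<Prod>k<Suc n. 1 - a * p ^ k) \<longlonglongrightarrow> qpoch a p"
    using qpoch_LIMSEQ[OF assms] by (rule LIMSEQ_Suc)
  have "(\<lambda>n. (1 - a) * (\<Prod>k<n. 1 - (a * p) * p ^ k)) \<longlonglongrightarrow> (1 - a) * qpoch (a * p) p"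
    by (intro tendsto_mult qpoch_LIMSEQ assms tendsto_const)
  then show "(\<lambda>n. \<Prod>k<Suc n. 1 - a * p ^ k) \<longlonglongrightarrow> (1 - a) * qpoch (a * p) p"
    by (simp add: prod.lessThan_Suc_shift mult.assoc del: prod.lessThan_Suc)
qed

lemma qpoch_mult_minus:
  assumes "norm p < 1"
  shows "qpoch a p * qpoch (- a) p = qpoch (a\<^sup>2) (p\<^sup>2)"
proof -
  have "qpoch a p * qpoch (- a) p = (\<Prod>n. (1 - a * p ^ n) * (1 - (- a) * p ^ n))"
    unfolding qpoch_def by (intro prodinf_mult convergent_prod_qpoch assms)
  also have "\<dots> = qpoch (a\<^sup>2) (p\<^sup>2)"
    unfolding qpoch_def by (rule prodinf_cong) (simp add: algebra_simps power2_eq_square power_mult_distrib)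
  finally show ?thesis .
qed

lemma prod_dissect:
  fixes f :: "nat \<Rightarrow> 'a :: comm_monoid_mult"
  shows "(\<Prod>k<n * m. f k) = (\<Prod>r<m. \<Prod>j<n. f (r + j * m))"
proof -
  have "(\<Prod>k<n * m. f k) = (\<Prod>j<n. \<Prod>r<m. f (r + j * m))"
    unfolding prod.nat_group[symmetric]
    using prod.shift_bounds_nat_ivl[of f 0 "j * m" m for j] by (simp add: add.commute lessThan_atLeast0)
  then show ?thesis by (subst (asm) prod.swap)
qed

text \<open>The factors are sorted by the residue of the exponent modulo \<open>m\<close>. Working
  with partial products of length \<open>n * m\<close> means that only finite products are
  rearranged.\<close>

lemma qpoch_dissect:
  assumes "norm p < 1" "m > 0"
  shows "qpoch a p = (\<Prod>r<m. qpoch (a * p ^ r) (p ^ m))"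
proof (rule LIMSEQ_unique)
  have "(\<lambda>n. \<Prod>k<n * m. 1 - a * p ^ k) \<longlonglongrightarrow> qpoch a p"
    using assms by (intro filterlim_compose[OF qpoch_LIMSEQ] mult_nat_right_at_top) auto
  then show "(\<lambda>n. \<Prod>r<m. \<Prod>j<n. 1 - (a * p ^ r) * (p ^ m) ^ j) \<longlonglongrightarrow> qpoch a p"
    by (simp add: prod_dissect power_add power_mult[symmetric] mult.assoc mult.commute[of m])
  show "(\<lambda>n. \<Prod>r<m. \<Prod>j<n. 1 - (a * p ^ r) * (p ^ m) ^ j) \<longlonglongrightarrow> (\<Prod>r<m. qpoch (a * p ^ r) (p ^ m))"
    using assms by (intro tendsto_prod qpoch_LIMSEQ) (auto simp: norm_power power_less_one_iff)
qed

text \<open>The Weierstrass test on a disc around \<open>a\<close> gives uniform convergence of the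
  partial products. The continuity is used where x tends to 1 in Kronecker's identity.\<close>

lemma continuous_qpoch:
  assumes "norm p < 1"
  shows "isCont (\<lambda>a. qpoch a p) a"
proof -
  define R where "R = norm a + 1"
  have "uniformly_convergent_on (cball 0 R) (\<lambda>N x. \<Sum>n<N. norm (1 - x * p ^ n - 1))"
  proof (rule Weierstrass_m_test')
    show "norm (norm (1 - x * p ^ n - 1)) \<le> R * norm p ^ n" if "x \<in> cball 0 R" for n x
      using that by (auto simp: norm_mult norm_power intro!: mult_right_mono)
    show "summable (\<lambda>n. R * norm p ^ n)"
      using assms by (intro summable_mult summable_geometric) auto
  qed
  then have "uniformly_convergent_on (cball 0 R) (\<lambda>N x. \<Prod>n<N. 1 - x * p ^ n)"
    by (rule uniformly_convergent_on_prod'[rotated 2]) (intro continuous_intros compact_cball)+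
  then have ul: "uniform_limit (cball 0 R) (\<lambda>N x. \<Prod>n<N. 1 - x * p ^ n) (\<lambda>x. lim (\<lambda>N. \<Prod>n<N. 1 - x * p ^ n)) sequentially"
    by (simp add: uniformly_convergent_uniform_limit_iff)
  have "continuous_on (cball 0 R) (\<lambda>x. lim (\<lambda>N. \<Prod>n<N. 1 - x * p ^ n))"
    by (rule uniform_limit_theorem[OF _ ul]) (auto intro!: continuous_intros always_eventually)
  also have "(\<lambda>x. lim (\<lambda>N. \<Prod>n<N. 1 - x * p ^ n)) = (\<lambda>x. qpoch x p)"
    using limI[OF qpoch_LIMSEQ[OF assms]] by blast
  finally have "continuous_on (ball 0 R) (\<lambda>x. qpoch x p)"
    by (rule continuous_on_subset) auto
  then show ?thesis
    by (rule continuous_on_interior) (auto simp: R_def)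
qed

text \<open>A quotient of q-factorials rather than a polynomial in \<open>p\<close>, so that bounds
  and limits can be read off from the infinite product. The value 0 above the diagonal makes the
  q-Pascal rule valid for all \<open>k\<close>.\<close>

definition gauss_binom :: "complex \<Rightarrow> nat \<Rightarrow> nat \<Rightarrow> complex" where
  "gauss_binom p n k =
     (if k \<le> n then (\<Prod>i<n. 1 - p * p ^ i) / ((\<Prod>i<k. 1 - p * p ^ i) * (\<Prod>i<n - k. 1 - p * p ^ i)) else 0)"

lemma qfact_nonzero:
  fixes p :: complex
  assumes "norm p < 1"
  shows "(\<Prod>i<n. 1 - p * p ^ i) \<noteq> 0"
proof -
  have "norm (p ^ Suc i) < 1" for i
    using assms by (simp add: norm_power power_less_one_iff del: power_Suc)
  then have "p * p ^ i \<noteq> 1" for i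
    by (metis less_irrefl norm_one power_Suc)
  then show ?thesis by auto
qed

lemma gauss_binom_0 [simp]: "norm p < 1 \<Longrightarrow> gauss_binom p n 0 = 1"
  using qfact_nonzero[of p n] by (simp add: gauss_binom_def)

lemma gauss_binom_Suc:
  assumes "norm p < 1"
  shows "gauss_binom p (Suc n) (Suc k) = gauss_binom p n (Suc k) + p ^ (n - k) * gauss_binom p n k"
proof -
  note nz = qfact_nonzero[OF assms]
  consider "k < n" | "k = n" | "k > n" by linarith
  then show ?thesis
  proof cases
    case 1
    then obtain m where n: "n = k + Suc m" by (auto dest: less_imp_Suc_add)
    have "1 - p * p ^ k \<noteq> 0" "1 - p * p ^ m \<noteq> 0"
      using nz[of "Suc k"] nz[of "Suc m"] by auto
    then show ?thesis
      using nz[of n] nz[of k] nz[of m]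
      by (simp add: gauss_binom_def n power_add divide_simps) (simp add: algebra_simps)
  next
    case 2
    then show ?thesis using nz[of n] nz[of "Suc n"] by (simp add: gauss_binom_def)
  qed (auto simp: gauss_binom_def)
qed

text \<open>In the q-Pascal rule the weight p^(n-i) meets the factor p^i from the quotient of
  consecutive theta terms. The shifted sum is therefore exactly -w p^n times the previous sum, which
  is the effect of the new factor 1 - w p^n.\<close>

lemma q_binomial_theorem:
  assumes "norm p < 1" "p \<noteq> 0"
  shows "(\<Prod>k<n. 1 - w * p ^ k) = (\<Sum>i\<le>n. gauss_binom p n i * theta_term p w (int i))"
proof (induction n)
  case 0
  then show ?case using assms by (simp add: theta_term_def)
next
  case (Suc n)
  define g where "g = gauss_binom p"
  define t where "t i = theta_term p w (int i)" for i
  have t: "t (Suc i) = - w * p ^ i * t i" for i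
    using assms tri_plus_one[of "int i"]
    by (simp add: t_def theta_term_def power_int_add add.commute)
  have "(\<Sum>i\<le>Suc n. g (Suc n) i * t i) = t 0 + (\<Sum>i\<le>n. g (Suc n) (Suc i) * t (Suc i))"
    using assms by (subst sum.atMost_Suc_shift) (simp add: g_def)
  also have "(\<Sum>i\<le>n. g (Suc n) (Suc i) * t (Suc i)) =
      (\<Sum>i\<le>n. g n (Suc i) * t (Suc i)) + (\<Sum>i\<le>n. - w * p ^ n * (g n i * t i))"
    unfolding sum.distrib[symmetric]
  proof (rule sum.cong)
    fix i assume "i \<in> {..n}"
    then have "p ^ n = p ^ (n - i) * p ^ i" by (simp flip: power_add)
    then show "g (Suc n) (Suc i) * t (Suc i) = g n (Suc i) * t (Suc i) + - w * p ^ n * (g n i * t i)"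
      by (simp add: g_def gauss_binom_Suc[OF assms(1)] t algebra_simps)
  qed auto
  also have "t 0 + ((\<Sum>i\<le>n. g n (Suc i) * t (Suc i)) + (\<Sum>i\<le>n. - w * p ^ n * (g n i * t i))) =
      (\<Sum>i\<le>Suc n. g n i * t i) - w * p ^ n * (\<Sum>i\<le>n. g n i * t i)"
    using assms by (subst sum.atMost_Suc_shift) (simp add: g_def sum_distrib_left sum_negf)
  also have "(\<Sum>i\<le>Suc n. g n i * t i) = (\<Sum>i\<le>n. g n i * t i)"
    by (simp add: g_def gauss_binom_def)
  finally show ?case
    using Suc by (simp add: g_def t_def algebra_simps)
qed

section \<open>The Jacobi triple product\<close>

lemma theta_term_succ:
  assumes "p \<noteq> 0" "z \<noteq> 0"
  shows "theta_term p z (k + 1) = - z * p powi k * theta_term p z k"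
  using assms by (simp add: theta_term_def tri_plus_one power_int_add)

text \<open>Because the exponent is quadratic, a shift of the index amounts to rescaling
  \<open>z\<close> by a power of \<open>p\<close>. This recentres the q-binomial sum at its middle
  term.\<close>

lemma theta_term_shift:
  assumes "p \<noteq> 0" "z \<noteq> 0"
  shows "theta_term p (z * p powi (- n)) k * theta_term p z (- n) = theta_term p z (k - n)"
proof -
  have t: "tri (k - n) = tri k + (- n) * k + tri (- n)"
    by (rule tri_eqI) (use two_tri[of k] two_tri[of "- n"] in \<open>simp add: algebra_simps\<close>)
  have "(- (z * p powi (- n))) powi k = (- z) powi k * p powi ((- n) * k)"
    unfolding power_int_mult power_int_mult_distrib[symmetric] by simp
  moreover have "p powi tri (k - n) = p powi tri k * p powi ((- n) * k) * p powi tri (- n)"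
    unfolding t by (simp only: power_int_add[OF disjI1[OF assms(1)]])
  moreover have "(- z) powi (k - n) = (- z) powi k * (- z) powi (- n)"
    using assms by (simp flip: power_int_add)
  ultimately show ?thesis
    unfolding theta_term_def by (simp only: mult_ac)
qed

lemma prod_lessThan_add:
  fixes f :: "nat \<Rightarrow> 'a :: comm_monoid_mult"
  shows "(\<Prod>k<m + n. f k) = (\<Prod>k<m. f k) * (\<Prod>k<n. f (m + k))"
  by (induction n) (simp_all add: mult.assoc)

text \<open>The q-binomial theorem with 2n factors, started at z p^(-n). The upper half of the
  factors is the product for \<open>z\<close>; the lower half, read backwards, becomes the product
  for \<open>p / z\<close> once -z / p^(k+1) is taken out of each factor.\<close>

lemma finite_triple_product:
  assumes p: "norm p < 1" "p \<noteq> 0" and z: "z \<noteq> 0"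
  shows "(\<Prod>k<n. 1 - z * p ^ k) * (\<Prod>k<n. 1 - (p / z) * p ^ k) =
    (\<Sum>i\<le>2 * n. gauss_binom p (2 * n) i * theta_term p z (int i - int n))"
proof -
  define w where "w = z * p powi (- int n)"
  have w: "w * p ^ (n + k) = z * p ^ k" for k
    using p by (simp add: w_def power_add power_int_minus)
  have "(\<Prod>k<2 * n. 1 - w * p ^ k) = (\<Prod>k<n. 1 - w * p ^ k) * (\<Prod>k<n. 1 - w * p ^ (n + k))"
    by (simp add: mult_2 prod_lessThan_add)
  also have "(\<Prod>k<n. 1 - w * p ^ k) = (\<Prod>k<n. 1 - w * p ^ (n - Suc k))"
    by (rule prod.nat_diff_reindex[symmetric])
  also have "\<dots> = (\<Prod>k<n. (- z / p ^ Suc k) * (1 - (p / z) * p ^ k))"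
  proof (rule prod.cong)
    fix k assume "k \<in> {..<n}"
    then have "p ^ n = p ^ (n - Suc k) * p ^ Suc k"
      by (subst power_add[symmetric]) simp
    then have "w * p ^ (n - Suc k) = z / p ^ Suc k"
      using p by (simp add: w_def power_int_minus field_simps)
    then show "1 - w * p ^ (n - Suc k) = (- z / p ^ Suc k) * (1 - (p / z) * p ^ k)"
      using p z by (simp add: field_simps)
  qed auto
  also have "\<dots> = (\<Prod>k<n. - z / p ^ Suc k) * (\<Prod>k<n. 1 - (p / z) * p ^ k)"
    by (rule prod.distrib)
  \<comment> \<open>The factors taken out multiply to the reciprocal of the theta term at index -n,
    which is just what \<open>theta_term_shift\<close> absorbs.\<close>
  also have "(\<Prod>k<n. - z / p ^ Suc k) = 1 / theta_term p z (- int n)"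
  proof (induction n)
    case (Suc n)
    define c where "c = - z / p ^ Suc n"
    have "theta_term p z (- int n) = - z * p powi (- int (Suc n)) * theta_term p z (- int (Suc n))"
      using theta_term_succ[OF p(2) z, of "- int (Suc n)"] by simp
    also have "- z * p powi (- int (Suc n)) = c"
      unfolding power_int_minus power_int_of_nat c_def by (simp add: divide_inverse)
    finally have "theta_term p z (- int n) = c * theta_term p z (- int (Suc n))" .
    moreover have "c \<noteq> 0" using p z by (simp add: c_def)
    ultimately show ?case
      unfolding prod.lessThan_Suc Suc c_def[symmetric] by simp
  qed (simp add: theta_term_def)
  finally have "theta_term p z (- int n) * (\<Prod>k<2 * n. 1 - w * p ^ k) =
     (\<Prod>k<n. 1 - z * p ^ k) * (\<Prod>k<n. 1 - (p / z) * p ^ k)"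
    using p z by (simp add: w theta_term_def)
  also have "theta_term p z (- int n) * (\<Prod>k<2 * n. 1 - w * p ^ k) =
    (\<Sum>i\<le>2 * n. gauss_binom p (2 * n) i * (theta_term p w (int i) * theta_term p z (- int n)))"
    by (simp add: q_binomial_theorem[OF p] sum_distrib_left mult_ac)
  also have "\<dots> = (\<Sum>i\<le>2 * n. gauss_binom p (2 * n) i * theta_term p z (int i - int n))"
    unfolding w_def theta_term_shift[OF p(2) z] ..
  finally show ?thesis ..
qed

text \<open>The q-factorials converge to a nonzero limit, so they and their reciprocals are bounded.
  Uniformity in \<open>n\<close> and \<open>k\<close> provides the majorant for the triple
  product.\<close>

lemma gauss_binom_bounded:
  assumes "norm p < 1"
  obtains M where "M \<ge> 0" "\<And>n k. norm (gauss_binom p n k) \<le> M"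
proof -
  define f where "f n = (\<Prod>i<n. 1 - p * p ^ i)" for n
  have lim: "f \<longlonglongrightarrow> qpoch p p"
    unfolding f_def by (rule qpoch_LIMSEQ[OF assms])
  have "qpoch p p \<noteq> 0" using assms by (intro qpoch_nonzero_norm)
  then have "(\<lambda>n. 1 / f n) \<longlonglongrightarrow> 1 / qpoch p p"
    by (intro tendsto_intros lim)
  then have "Bseq (\<lambda>n. 1 / f n)" by (intro convergent_imp_Bseq) (auto simp: convergent_def)
  then obtain V where V: "V > 0" "\<And>n. norm (1 / f n) \<le> V" by (auto simp: Bseq_def)
  have "Bseq f" using lim by (intro convergent_imp_Bseq) (auto simp: convergent_def)
  then obtain U where U: "U > 0" "\<And>n. norm (f n) \<le> U" by (auto simp: Bseq_def)
  have "norm (gauss_binom p n k) \<le> U * (V * V)" for n k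
  proof (cases "k \<le> n")
    case True
    then have "norm (gauss_binom p n k) = norm (f n) * (norm (1 / f k) * norm (1 / f (n - k)))"
      by (simp add: gauss_binom_def f_def norm_divide norm_mult)
    also have "\<dots> \<le> U * (V * V)"
      using U V by (intro mult_mono mult_nonneg_nonneg) (auto simp: less_imp_le)
    finally show ?thesis .
  qed (use U V in \<open>simp add: gauss_binom_def\<close>)
  then show ?thesis using that[of "U * (V * V)"] U V by simp
qed

text \<open>Termwise limit of the finite version: the Gaussian binomial at fixed distance j from the
  centre tends to E / (E E) = 1 / E, and a multiple of the theta terms dominates.\<close>

theorem jacobi_triple_product:
  assumes p: "norm p < 1" "p \<noteq> 0" and z: "z \<noteq> 0"
  shows "theta p z = qpoch p p * qpoch z p * qpoch (p / z) p"
proof -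
  define E where "E = qpoch p p"
  have E: "E \<noteq> 0" unfolding E_def using p by (intro qpoch_nonzero_norm)
  \<comment> \<open>Extension by 0 puts all the finite sums on the same index set, the
    integers.\<close>
  define c where "c n j = (if \<bar>j\<bar> \<le> int n then gauss_binom p (2 * n) (nat (int n + j)) else 0)" for n j
  obtain M where M: "M \<ge> 0" "\<And>n k. norm (gauss_binom p n k) \<le> M"
    using gauss_binom_bounded[OF p(1)] by blast
  have fin: "(\<Prod>k<n. 1 - z * p ^ k) * (\<Prod>k<n. 1 - (p / z) * p ^ k) =
      (\<Sum>\<^sub>\<infinity>j. c n j * theta_term p z j)" for n
  proof -
    have "(\<Sum>\<^sub>\<infinity>j. c n j * theta_term p z j) = (\<Sum>\<^sub>\<infinity>j\<in>{- int n..int n}. c n j * theta_term p z j)"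
      by (rule infsum_cong_neutral) (auto simp: c_def)
    also have "\<dots> = (\<Sum>j\<in>{- int n..int n}. c n j * theta_term p z j)" by simp
    also have "\<dots> = (\<Sum>i\<le>2 * n. gauss_binom p (2 * n) i * theta_term p z (int i - int n))"
      by (rule sum.reindex_bij_witness[of _ "\<lambda>i. int i - int n" "\<lambda>j. nat (int n + j)"])
         (auto simp: c_def abs_le_iff)
    finally show ?thesis using finite_triple_product[OF p z] by simp
  qed
  have lim: "(\<lambda>n. c n j) \<longlonglongrightarrow> 1 / E" for j
  proof -
    define f where "f n = (\<Prod>i<n. 1 - p * p ^ i)" for n
    have f: "f \<longlonglongrightarrow> E" unfolding f_def E_def by (rule qpoch_LIMSEQ[OF p(1)])
    have fl: "filterlim (\<lambda>n. nat (int n + i)) at_top sequentially" for i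
      unfolding filterlim_at_top
    proof
      fix N
      show "\<forall>\<^sub>F n in sequentially. N \<le> nat (int n + i)"
        using eventually_ge_at_top[of "N + nat (- i)"] by eventually_elim auto
    qed
    have "(\<lambda>n. f (2 * n) / (f (nat (int n + j)) * f (nat (int n + (- j))))) \<longlonglongrightarrow> E / (E * E)"
      using E by (intro tendsto_intros filterlim_compose[OF f] fl mult_nat_left_at_top) auto
    then have "(\<lambda>n. f (2 * n) / (f (nat (int n + j)) * f (nat (int n + (- j))))) \<longlonglongrightarrow> 1 / E"
      using E by simp
    moreover have "\<forall>\<^sub>F n in sequentially.
       f (2 * n) / (f (nat (int n + j)) * f (nat (int n + (- j)))) = c n j"
      using eventually_ge_at_top[of "nat \<bar>j\<bar>"]
    proof eventually_elim
      case (elim n)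
      then have "\<bar>j\<bar> \<le> int n" "nat (int n + j) \<le> 2 * n" "2 * n - nat (int n + j) = nat (int n + (- j))"
        by auto
      then show ?case by (simp add: c_def gauss_binom_def f_def)
    qed
    ultimately show ?thesis by (rule Lim_transform_eventually)
  qed
  have "(\<lambda>n. \<Sum>\<^sub>\<infinity>j. c n j * theta_term p z j) \<longlonglongrightarrow> (\<Sum>\<^sub>\<infinity>j. 1 / E * theta_term p z j)"
  proof (rule tendsto_infsum_int)
    show "\<forall>\<^sub>F n in sequentially. \<forall>j. norm (c n j * theta_term p z j) \<le> M * norm (theta_term p z j)"
      using M by (intro always_eventually) (auto simp: norm_mult c_def intro!: mult_right_mono)
    show "(\<lambda>j. M * norm (theta_term p z j)) summable_on UNIV"
      using p z by (intro summable_on_cmult_right theta_summable)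
    show "(\<lambda>n. c n j * theta_term p z j) \<longlonglongrightarrow> 1 / E * theta_term p z j" for j
      by (intro tendsto_mult lim tendsto_const)
  qed auto
  moreover have "(\<lambda>n. (\<Prod>k<n. 1 - z * p ^ k) * (\<Prod>k<n. 1 - (p / z) * p ^ k)) \<longlonglongrightarrow> qpoch z p * qpoch (p / z) p"
    by (intro tendsto_mult qpoch_LIMSEQ p)
  ultimately have "(\<Sum>\<^sub>\<infinity>j. 1 / E * theta_term p z j) = qpoch z p * qpoch (p / z) p"
    unfolding fin by (rule LIMSEQ_unique)
  then have "theta p z / E = qpoch z p * qpoch (p / z) p"
    unfolding infsum_cmult_right' theta_def by simp
  then show ?thesis using E by (simp add: E_def field_simps)
qed

section \<open>Kronecker's bilateral series\<close>

definition kron_term :: "complex \<Rightarrow> complex \<Rightarrow> complex \<Rightarrow> int \<Rightarrow> complex" where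
  "kron_term p a x n = x powi n / (1 - a * p powi n)"

context
  fixes p a :: complex
  assumes p: "p \<noteq> 0" "norm p < 1" and a: "a \<noteq> 0" "\<And>n::int. a * p powi n \<noteq> 1"
begin

text \<open>For negative indices 1 / (1 - a p^(-n)) = p^n / (p^n - a). This decay of order |p|^n
  gives convergence down to |x| > |p|, while boundedness at nonnegative indices gives it for |x| <
  1.\<close>

lemma kron_coeff_bounded:
  obtains M where "M \<ge> 0" "\<And>n. norm (1 / (1 - a * p powi int n)) \<le> M"
    "\<And>n. norm (1 / (1 - a * p powi (- int n))) \<le> M * norm p ^ n"
proof -
  have lim: "(\<lambda>n. p ^ n) \<longlonglongrightarrow> 0" using p by (intro LIMSEQ_power_zero)
  have "(\<lambda>n. 1 / (1 - a * p ^ n)) \<longlonglongrightarrow> 1 / (1 - a * 0)"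
    by (intro tendsto_intros lim) auto
  then have "Bseq (\<lambda>n. 1 / (1 - a * p ^ n))" by (intro convergent_imp_Bseq) (auto simp: convergent_def)
  then obtain U where U: "U > 0" "\<And>n. norm (1 / (1 - a * p ^ n)) \<le> U" by (auto simp: Bseq_def)
  have "(\<lambda>n. 1 / (p ^ n - a)) \<longlonglongrightarrow> 1 / (0 - a)"
    using a by (intro tendsto_intros lim) auto
  then have "Bseq (\<lambda>n. 1 / (p ^ n - a))" by (intro convergent_imp_Bseq) (auto simp: convergent_def)
  then obtain V where V: "V > 0" "\<And>n. norm (1 / (p ^ n - a)) \<le> V" by (auto simp: Bseq_def)
  show ?thesis
  proof (rule that[of "U + V"])
    show "norm (1 / (1 - a * p powi int n)) \<le> U + V" for n
      using U(2)[of n] V by simp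
    show "norm (1 / (1 - a * p powi (- int n))) \<le> (U + V) * norm p ^ n" for n
    proof -
      have "1 - a * p powi (- int n) = (p ^ n - a) / p ^ n"
        using p by (simp add: power_int_minus field_simps)
      then have "norm (1 / (1 - a * p powi (- int n))) = norm (1 / (p ^ n - a)) * norm p ^ n"
        by (simp add: norm_divide norm_power)
      also have "\<dots> \<le> (U + V) * norm p ^ n"
        using V(2)[of n] U by (intro mult_right_mono) auto
      finally show ?thesis .
    qed
  qed (use U V in auto)
qed

lemma kron_summable:
  assumes x: "norm p < norm x" "norm x < 1"
  shows "(\<lambda>n. norm (kron_term p a x n)) summable_on UNIV"
proof -
  obtain M where M: "M \<ge> 0" "\<And>n. norm (1 / (1 - a * p powi int n)) \<le> M"
    "\<And>n. norm (1 / (1 - a * p powi (- int n))) \<le> M * norm p ^ n"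
    using kron_coeff_bounded by blast
  have x0: "x \<noteq> 0" using x by auto
  show ?thesis
  proof (rule int_abs_summableI)
    show "summable (\<lambda>n. norm (kron_term p a x (int n)))"
    proof (rule summable_comparison_test')
      show "summable (\<lambda>n. M * norm x ^ n)"
        using x by (intro summable_mult summable_geometric) auto
      show "norm (norm (kron_term p a x (int n))) \<le> M * norm x ^ n" for n
      proof -
        have "norm (kron_term p a x (int n)) = norm (1 / (1 - a * p powi int n)) * norm x ^ n"
          by (simp add: kron_term_def norm_divide norm_power)
        then show ?thesis using M(2)[of n] by (simp add: mult_right_mono)
      qed
    qed
    show "summable (\<lambda>n. norm (kron_term p a x (- int n)))"
    proof (rule summable_comparison_test')
      show "summable (\<lambda>n. M * (norm p / norm x) ^ n)"
        using x x0 by (intro summable_mult summable_geometric) auto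
      show "norm (norm (kron_term p a x (- int n))) \<le> M * (norm p / norm x) ^ n" for n
      proof -
        have "norm (kron_term p a x (- int n)) = norm (1 / (1 - a * p powi (- int n))) * (1 / norm x ^ n)"
          by (simp add: kron_term_def norm_divide norm_power power_int_minus divide_inverse norm_mult norm_inverse)
        also have "\<dots> \<le> (M * norm p ^ n) * (1 / norm x ^ n)"
          by (intro mult_right_mono M) auto
        finally show ?thesis by (simp add: power_divide)
      qed
    qed
  qed
qed

text \<open>The coefficient of x^m in the product of \<open>theta p x\<close> with Kronecker's
  series, since \<open>theta_term p x k\<close> is x^k times
  \<open>theta_term p 1 k\<close>.\<close>

definition kron_S :: "int \<Rightarrow> complex" where
  "kron_S m = (\<Sum>\<^sub>\<infinity>k. theta_term p 1 k * (1 / (1 - a * p powi (m - k))))"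

text \<open>Apply 1 / (1 - y) = 1 + y / (1 - y) with y = a p^(m-k). The ones add up to
  \<open>theta p 1\<close>, which is 0; in the rest, p^(m-k) combines with the factor p^k of the
  shifted theta term to p^m, independent of \<open>k\<close>.\<close>

lemma kron_S_Suc: "kron_S (m + 1) = - (a * p powi m) * kron_S m"
proof -
  obtain M where M: "M \<ge> 0" "\<And>n. norm (1 / (1 - a * p powi int n)) \<le> M"
    "\<And>n. norm (1 / (1 - a * p powi (- int n))) \<le> M * norm p ^ n"
    using kron_coeff_bounded by blast
  define g where "g n = 1 / (1 - a * p powi n)" for n :: int
  have gM: "norm (g n) \<le> M" for n
  proof (cases n rule: int_cases2)
    case (nonpos k)
    have "norm (g n) \<le> M * norm p ^ k" using M(3)[of k] by (simp add: g_def nonpos)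
    also have "\<dots> \<le> M * 1" using M p by (intro mult_left_mono power_le_one) auto
    finally show ?thesis by simp
  qed (use M(2) in \<open>simp add: g_def\<close>)
  have s1: "(\<lambda>k. theta_term p 1 k) summable_on UNIV"
    using theta_summable[OF p, of 1] abs_summable_summable by auto
  then have s1': "(\<lambda>k. theta_term p 1 (k + 1)) summable_on UNIV"
    using summable_on_reindex_bij_witness[of UNIV "\<lambda>k. k - 1" "\<lambda>k. k + 1" UNIV
       "theta_term p 1" "\<lambda>k. theta_term p 1 (k + 1)"] by simp
  have "(\<lambda>k. norm (theta_term p 1 k * g (m - k))) summable_on UNIV"
  proof (rule summable_on_comparison_test)
    show "(\<lambda>k. M * norm (theta_term p 1 k)) summable_on UNIV"
      by (intro summable_on_cmult_right theta_summable p) auto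
    show "norm (theta_term p 1 k * g (m - k)) \<le> M * norm (theta_term p 1 k)" for k
      unfolding norm_mult using gM[of "m - k"] by (subst mult.commute) (rule mult_right_mono, auto)
  qed auto
  then have s2: "(\<lambda>k. theta_term p 1 k * g (m - k)) summable_on UNIV"
    by (rule abs_summable_summable)
  have "kron_S (m + 1) = (\<Sum>\<^sub>\<infinity>k. theta_term p 1 (k + 1) * g (m + 1 - (k + 1)))"
    unfolding kron_S_def g_def[symmetric] by (rule infsum_int_shift[symmetric])
  also have "\<dots> = (\<Sum>\<^sub>\<infinity>k. theta_term p 1 (k + 1) + (- (a * p powi m)) * (theta_term p 1 k * g (m - k)))"
  proof (rule infsum_cong)
    fix k
    have "g (m - k) = 1 + a * p powi (m - k) * g (m - k)"
      using a(2)[of "m - k"] by (simp add: g_def field_simps)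
    then have "p powi k * g (m - k) = p powi k + a * (p powi k * p powi (m - k)) * g (m - k)"
      by (metis (no_types, opaque_lifting) distrib_left mult.assoc mult.left_commute mult_1_right)
    also have "p powi k * p powi (m - k) = p powi m"
      using p by (simp flip: power_int_add)
    finally have "p powi k * g (m - k) = p powi k + a * p powi m * g (m - k)" .
    then have "- theta_term p 1 k * (p powi k * g (m - k)) = - theta_term p 1 k * (p powi k + a * p powi m * g (m - k))"
      by simp
    then show "theta_term p 1 (k + 1) * g (m + 1 - (k + 1)) =
        theta_term p 1 (k + 1) + (- (a * p powi m)) * (theta_term p 1 k * g (m - k))"
      using theta_term_succ[OF p(1), of 1 k] by (simp add: algebra_simps)
  qed
  also have "\<dots> = theta p 1 + (- (a * p powi m)) * (\<Sum>\<^sub>\<infinity>k. theta_term p 1 k * g (m - k))"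
    by (subst infsum_add[OF s1' summable_on_cmult_right[OF s2]])
       (simp only: infsum_cmult_right' infsum_int_shift theta_def)
  finally show ?thesis
    using theta_one[OF p(1)] by (simp add: kron_S_def g_def)
qed

lemma kron_S_eq: "kron_S m = kron_S 0 * theta_term p a m"
proof (induction m rule: int_induct[of _ 0])
  case base
  show ?case by (simp add: theta_term_def)
next
  case (step1 i)
  then show ?case using kron_S_Suc[of i] theta_term_succ[OF p(1) a(1), of i] by simp
next
  case (step2 i)
  \<comment> \<open>Downwards the recurrence is solved by cancelling its nonzero factor.\<close>
  have "- (a * p powi (i - 1)) * kron_S (i - 1) = - (a * p powi (i - 1)) * (kron_S 0 * theta_term p a (i - 1))"
    using step2 kron_S_Suc[of "i - 1"] theta_term_succ[OF p(1) a(1), of "i - 1"] by auto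
  then show ?case
    by (rule mult_left_cancel[THEN iffD1, rotated]) (use p a in auto)
qed

text \<open>A Cauchy product of bilateral series: absolute convergence in the annulus allows the
  double sum to be sorted by m = k + n, and the inner sums are x^m times
  \<open>kron_S m\<close>.\<close>

lemma theta_mult_kron_S:
  assumes x: "norm p < norm x" "norm x < 1"
  shows "theta p x * (\<Sum>\<^sub>\<infinity>n. kron_term p a x n) = kron_S 0 * theta p (a * x)"
proof -
  have x0: "x \<noteq> 0" using x by auto
  define F where "F = (\<lambda>(k, n). theta_term p x k * kron_term p a x n)"
  have sF: "(\<lambda>z. norm (F z)) summable_on UNIV"
    using abs_summable_on_product[OF theta_summable[OF p x0] kron_summable[OF x]]
    by (simp add: F_def)
  have F: "F (k, m - k) = x powi m * (theta_term p 1 k * (1 / (1 - a * p powi (m - k))))" for k m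
    using x0 by (simp add: F_def theta_term_def kron_term_def power_int_diff power_int_minus_left)
  have "theta p x * (\<Sum>\<^sub>\<infinity>n. kron_term p a x n) = infsum F UNIV"
    unfolding theta_def F_def
    by (subst infsum_mult_product[OF theta_summable[OF p x0] kron_summable[OF x]]) simp
  also have "\<dots> = (\<Sum>\<^sub>\<infinity>(m, k). F (k, m - k))"
    by (rule infsum_reindex_bij_witness[of _ "\<lambda>(m, k). (k, m - k)" "\<lambda>(k, n). (k + n, k)"]) auto
  also have "\<dots> = (\<Sum>\<^sub>\<infinity>m. \<Sum>\<^sub>\<infinity>k. F (k, m - k))"
  proof -
    have "F summable_on UNIV" by (rule abs_summable_summable[OF sF])
    then have "(\<lambda>(m, k). F (k, m - k)) summable_on (UNIV :: (int \<times> int) set)"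
      using summable_on_reindex_bij_witness[of UNIV "\<lambda>(m, k). (k, m - k)" "\<lambda>(k, n). (k + n, k)" UNIV
         "\<lambda>(m, k). F (k, m - k)" F] by auto
    then show ?thesis
      using infsum_Sigma'_banach[of "\<lambda>m k. F (k, m - k)" UNIV "\<lambda>_. UNIV"] by simp
  qed
  also have "\<dots> = (\<Sum>\<^sub>\<infinity>m. kron_S 0 * theta_term p (a * x) m)"
  proof (rule infsum_cong)
    fix m
    have "(\<Sum>\<^sub>\<infinity>k. F (k, m - k)) = x powi m * kron_S m"
      unfolding F infsum_cmult_right' kron_S_def ..
    also have "\<dots> = kron_S 0 * theta_term p (a * x) m"
      by (subst kron_S_eq) (simp add: theta_term_def power_int_minus_left power_int_mult_distrib)
    finally show "(\<Sum>\<^sub>\<infinity>k. F (k, m - k)) = kron_S 0 * theta_term p (a * x) m" .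
  qed
  also have "\<dots> = kron_S 0 * theta p (a * x)"
    by (simp add: infsum_cmult_right' theta_def)
  finally show ?thesis .
qed

text \<open>
  Only the terms with nonnegative index are unbounded as x tends to 1, and they behave like a
  geometric series.
\<close>

lemma kron_sum_asymp:
  "((\<lambda>t::real. (1 - of_real t) * (\<Sum>\<^sub>\<infinity>n. kron_term p a (of_real t) n)) \<longlongrightarrow> 1) (at_left 1)"
proof -
  \<comment> \<open>Any radius strictly between |p| and 1 would do. For r < t < 1 the series at
    \<open>r\<close> dominates: |p|^k \<le> r^k at nonnegative indices, t^(-k) \<le> r^(-k) at
    negative ones.\<close>
  define r where "r = (1 + norm p) / 2"
  have r: "norm p < r" "r < 1" "0 < r" using p by (auto simp: r_def add_pos_nonneg)
  \<comment> \<open>The part of the coefficients that produces the pole; the remainder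
    \<open>H\<close> decays like |p|^|n| in both directions.\<close>
  define I where "I n = (if n \<ge> 0 then 1 else 0 :: complex)" for n :: int
  define H where "H n = 1 / (1 - a * p powi n) - I n" for n
  define K where "K n = norm (kron_term p a (of_real r) n)" for n
  have K: "K summable_on UNIV"
    unfolding K_def using r by (intro kron_summable) auto
  have bound: "norm (complex_of_real t powi n * H n) \<le> (1 + norm a) * K n" if t: "r < t" "t < 1" for t n
  proof (cases "n \<ge> 0")
    case True
    then obtain k where k: "n = int k" by (metis zero_le_imp_eq_int)
    have "H n = a * p ^ k * (1 / (1 - a * p powi n))"
      using a(2)[of n] by (simp add: H_def I_def k field_simps)
    then have "norm (complex_of_real t powi n * H n) =
        t ^ k * (norm a * norm p ^ k * norm (1 / (1 - a * p powi n)))"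
      using t r by (simp add: k norm_mult norm_power norm_divide)
    also have "\<dots> \<le> 1 * (norm a * r ^ k * norm (1 / (1 - a * p powi n)))"
      using t r by (intro mult_mono power_le_one power_mono) auto
    also have "\<dots> = norm a * K n"
      using r by (simp add: K_def kron_term_def k norm_divide norm_power)
    also have "\<dots> \<le> (1 + norm a) * K n"
      by (intro mult_right_mono) (auto simp: K_def)
    finally show ?thesis .
  next
    case False
    then obtain k where k: "n = - int k" by (metis int_cases2 le_minus_iff neg_0_le_iff_le of_nat_0_le_iff)
    have "norm (complex_of_real t powi n * H n) = (1 / t) ^ k * norm (1 / (1 - a * p powi n))"
      using False t r by (simp add: H_def I_def k norm_mult norm_power power_int_minus norm_inverse
          power_inverse divide_inverse)
    also have "\<dots> \<le> (1 / r) ^ k * norm (1 / (1 - a * p powi n))"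
      using t r by (intro mult_right_mono power_mono) (auto simp: field_simps)
    also have "\<dots> = 1 * K n"
      using r by (simp add: K_def kron_term_def k norm_mult norm_power power_int_minus norm_inverse
          power_inverse divide_inverse)
    also have "\<dots> \<le> (1 + norm a) * K n"
      by (intro mult_right_mono) (auto simp: K_def)
    finally show ?thesis .
  qed
  have ev: "eventually (\<lambda>t. t \<in> {r<..<1}) (at_left 1)"
    using r by (intro eventually_at_leftI) auto
  have sM: "(\<lambda>n. (1 + norm a) * K n) summable_on UNIV"
    by (intro summable_on_cmult_right K)
  have "((\<lambda>t. \<Sum>\<^sub>\<infinity>n. (1 - complex_of_real t) * (complex_of_real t powi n * H n)) \<longlongrightarrow> (\<Sum>\<^sub>\<infinity>n::int. (0 :: complex))) (at_left 1)"
  proof (rule tendsto_infsum_int[where M = "\<lambda>n. (1 + norm a) * K n"])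
    show "((\<lambda>t. (1 - complex_of_real t) * (complex_of_real t powi n * H n)) \<longlongrightarrow> 0) (at_left 1)" for n
      by (rule tendsto_eq_intros refl tendsto_power_int | simp)+
    show "\<forall>\<^sub>F t in at_left 1. \<forall>n. norm ((1 - complex_of_real t) * (complex_of_real t powi n * H n)) \<le> (1 + norm a) * K n"
      using ev
    proof eventually_elim
      case (elim t)
      have "norm (complex_of_real (1 - t)) \<le> 1"
        using elim r unfolding norm_of_real by auto
      then have "norm (1 - complex_of_real t) \<le> 1" by simp
      then have "norm (1 - complex_of_real t) * norm (complex_of_real t powi n * H n) \<le> 1 * ((1 + norm a) * K n)" for n
        using elim by (intro mult_mono bound) auto
      then show ?case by (simp only: norm_mult mult_1_left) blast
    qed
  qed (use sM in auto)
  then have "((\<lambda>t. 1 + (\<Sum>\<^sub>\<infinity>n. (1 - complex_of_real t) * (complex_of_real t powi n * H n))) \<longlongrightarrow> 1) (at_left 1)"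
    by (auto intro!: tendsto_eq_intros)
  moreover have "\<forall>\<^sub>F t in at_left 1. 1 + (\<Sum>\<^sub>\<infinity>n. (1 - complex_of_real t) * (complex_of_real t powi n * H n)) =
       (1 - of_real t) * (\<Sum>\<^sub>\<infinity>n. kron_term p a (of_real t) n)"
    using ev
  proof eventually_elim
    case (elim t)
    define z where "z = complex_of_real t"
    have z: "norm z < 1" "z \<noteq> 1" using elim r by (auto simp: z_def)
    have "((\<lambda>n. z ^ n) has_sum 1 / (1 - z)) UNIV"
      using z by (intro norm_summable_imp_has_sum geometric_sums) (auto simp: norm_power)
    then have "((\<lambda>n. z powi n * I n) has_sum 1 / (1 - z)) (range int)"
      by (subst has_sum_reindex) (auto simp: o_def I_def)
    then have sI: "((\<lambda>n. z powi n * I n) has_sum 1 / (1 - z)) UNIV"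
      by (rule has_sum_cong_neutral[THEN iffD1, rotated -1])
         (auto simp: I_def image_iff dest: zero_le_imp_eq_int)
    have sH: "(\<lambda>n. z powi n * H n) summable_on UNIV"
      by (rule abs_summable_summable, rule summable_on_comparison_test[OF sM])
         (use bound elim in \<open>auto simp: z_def\<close>)
    have "(\<Sum>\<^sub>\<infinity>n. kron_term p a z n) = (\<Sum>\<^sub>\<infinity>n. z powi n * I n + z powi n * H n)"
      by (rule infsum_cong) (simp add: kron_term_def H_def field_simps)
    also have "\<dots> = 1 / (1 - z) + (\<Sum>\<^sub>\<infinity>n. z powi n * H n)"
      using sI by (subst infsum_add[OF _ sH]) (auto simp: has_sum_iff)
    finally show ?case
      using z by (simp add: z_def[symmetric] infsum_cmult_right' distrib_left)
  qed
  ultimately show ?thesis by (rule Lim_transform_eventually)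
qed

text \<open>The factor 1 - t of \<open>theta p t\<close> cancels the simple pole of the series. What
  is left of theta is the product E(p) (pt;p) (p/t;p), whose limit is the cube, while the other side
  tends to \<open>kron_S 0 * theta p a\<close>.\<close>

lemma kron_S_0: "kron_S 0 * theta p a = euler_E p ^ 3"
proof (rule tendsto_unique[of "at_left (1::real)"])
  define K where "K t = (\<Sum>\<^sub>\<infinity>n. kron_term p a (complex_of_real t) n)" for t
  have ct: "((\<lambda>t. qpoch (c * complex_of_real t) p) \<longlongrightarrow> qpoch c p) (at_left 1)"
    "((\<lambda>t. qpoch (c / complex_of_real t) p) \<longlongrightarrow> qpoch c p) (at_left 1)" for c
    by (rule isCont_tendsto_compose[OF continuous_qpoch[OF p(2)]], (rule tendsto_eq_intros refl | simp)+)+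
  have "((\<lambda>t. kron_S 0 * (euler_E p * qpoch (a * complex_of_real t) p * qpoch (p / a / complex_of_real t) p))
      \<longlongrightarrow> kron_S 0 * (euler_E p * qpoch a p * qpoch (p / a) p)) (at_left 1)"
    by (intro tendsto_intros ct)
  then show "((\<lambda>t. kron_S 0 * (euler_E p * qpoch (a * complex_of_real t) p * qpoch (p / a / complex_of_real t) p))
      \<longlongrightarrow> kron_S 0 * theta p a) (at_left 1)"
    using p a by (simp add: jacobi_triple_product euler_E_eq_qpoch)
  have "((\<lambda>t. euler_E p * qpoch (p * complex_of_real t) p * qpoch (p / complex_of_real t) p *
       ((1 - complex_of_real t) * K t)) \<longlongrightarrow> euler_E p * qpoch p p * qpoch p p * 1) (at_left 1)"
    unfolding K_def by (intro tendsto_mult ct kron_sum_asymp tendsto_const)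
  then have lim: "((\<lambda>t. euler_E p * qpoch (p * complex_of_real t) p * qpoch (p / complex_of_real t) p *
       ((1 - complex_of_real t) * K t)) \<longlongrightarrow> euler_E p ^ 3) (at_left 1)"
    by (simp add: euler_E_eq_qpoch power3_eq_cube)
  have "eventually (\<lambda>t. t \<in> {norm p<..<1}) (at_left 1)"
    using p by (intro eventually_at_leftI) auto
  then have "\<forall>\<^sub>F t in at_left 1. euler_E p * qpoch (p * complex_of_real t) p * qpoch (p / complex_of_real t) p *
       ((1 - complex_of_real t) * K t) =
     kron_S 0 * (euler_E p * qpoch (a * complex_of_real t) p * qpoch (p / a / complex_of_real t) p)"
  proof eventually_elim
    case (elim t)
    define z where "z = complex_of_real t"
    have z: "norm p < norm z" "norm z < 1"
      using elim le_less_trans[OF norm_ge_zero[of p], of t] unfolding z_def norm_of_real by auto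
    then have z0: "z \<noteq> 0" by auto
    have "theta p z * K t = kron_S 0 * theta p (a * z)"
      unfolding K_def z_def[symmetric] by (rule theta_mult_kron_S[OF z])
    moreover have "theta p z = euler_E p * ((1 - z) * qpoch (p * z) p) * qpoch (p / z) p"
      using jacobi_triple_product[OF p(2,1) z0] qpoch_rec[OF p(2), of z]
      by (simp add: euler_E_eq_qpoch mult.commute)
    moreover have "theta p (a * z) = euler_E p * qpoch (a * z) p * qpoch (p / a / z) p"
      using jacobi_triple_product[OF p(2,1), of "a * z"] z0 a by (simp add: euler_E_eq_qpoch)
    ultimately show ?case
      by (simp add: z_def[symmetric] mult_ac)
  qed
  then show "((\<lambda>t. kron_S 0 * (euler_E p * qpoch (a * complex_of_real t) p * qpoch (p / a / complex_of_real t) p))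
      \<longlongrightarrow> euler_E p ^ 3) (at_left 1)"
    by (rule Lim_transform_eventually[OF lim])
qed simp

theorem kronecker_theta_identity:
  assumes x: "norm p < norm x" "norm x < 1"
  shows "theta p a * theta p x * (\<Sum>\<^sub>\<infinity>n. kron_term p a x n) = euler_E p ^ 3 * theta p (a * x)"
  using theta_mult_kron_S[OF x] kron_S_0 by (metis mult.assoc mult.commute)

end

section \<open>The Kronecker symbol of -6\<close>

lemma Legendre_3: "Legendre a 3 = (if a mod 3 = 0 then 0 else if a mod 3 = 1 then 1 else -1)"
proof -
  have "QuadRes 3 a \<longleftrightarrow> a mod 3 = 0 \<or> a mod 3 = 1"
  proof
    assume "QuadRes 3 a"
    then obtain y where y: "y\<^sup>2 mod 3 = a mod 3" by (auto simp: QuadRes_def cong_def)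
    have "y mod 3 = 0 \<or> y mod 3 = 1 \<or> y mod 3 = 2" by presburger
    then have "(y mod 3)\<^sup>2 mod 3 \<in> {0, 1}" by auto
    then show "a mod 3 = 0 \<or> a mod 3 = 1" using y by (auto simp: power_mod)
  next
    assume "a mod 3 = 0 \<or> a mod 3 = 1"
    then show "QuadRes 3 a"
      by (auto simp: QuadRes_def cong_def intro: exI[of _ 0] exI[of _ 1])
  qed
  then show ?thesis by (auto simp: Legendre_def cong_def)
qed

text \<open>The Dirichlet character modulo 24 attached to -6, in explicit form: (n/3) times (2/n).
  The second factor is written as the local symbol at 2, which agrees with (2/n) for positive odd n
  and vanishes for even n.\<close>

definition chi :: "int \<Rightarrow> int" where
  "chi n = Legendre n 3 * kronecker_prime n 2"

lemma kronecker_prime_2: "kronecker_prime a 2 = (if even a then 0 else if a mod 8 \<in> {1, 7} then 1 else -1)"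
  by (simp add: kronecker_prime_def)

lemma chi_mult: "chi (a * b) = chi a * chi b"
proof -
  have "Legendre (a * b) 3 = Legendre a 3 * Legendre b 3"
  proof -
    have ab: "a * b mod 3 = (a mod 3) * (b mod 3) mod 3" by (rule mod_mult_eq[symmetric])
    have "a mod 3 = 0 \<or> a mod 3 = 1 \<or> a mod 3 = 2" by presburger
    then consider "a mod 3 = 0" | "a mod 3 = 1" | "a mod 3 = 2" by blast
    then show ?thesis
    proof cases
      case 3
      have "b mod 3 = 0 \<or> b mod 3 = 1 \<or> b mod 3 = 2" by presburger
      then show ?thesis unfolding Legendre_3 ab by (elim disjE) (simp_all only: 3, simp_all)
    qed (simp_all only: Legendre_3 ab, simp_all)
  qed
  moreover have "kronecker_prime (a * b) 2 = kronecker_prime a 2 * kronecker_prime b 2"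
  proof (cases "even a \<or> even b")
    case False
    have ab: "a * b mod 8 = (a mod 8) * (b mod 8) mod 8" by (rule mod_mult_eq[symmetric])
    have "odd (a * b)" using False by simp
    have "a mod 8 = 1 \<or> a mod 8 = 3 \<or> a mod 8 = 5 \<or> a mod 8 = 7"
      using False by presburger
    moreover have "b mod 8 = 1 \<or> b mod 8 = 3 \<or> b mod 8 = 5 \<or> b mod 8 = 7"
      using False by presburger
    ultimately have "(if a * b mod 8 \<in> {1, 7} then 1 else -1 :: int) =
       (if a mod 8 \<in> {1, 7} then 1 else -1) * (if b mod 8 \<in> {1, 7} then 1 else -1)"
      unfolding ab by (elim disjE) (simp_all only:, simp_all)
    moreover have "kronecker_prime x 2 = (if x mod 8 \<in> {1, 7} then 1 else -1)" if "odd x" for x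
      using that by (simp add: kronecker_prime_2)
    ultimately show ?thesis using False \<open>odd (a * b)\<close> by simp
  qed (auto simp: kronecker_prime_2)
  ultimately show ?thesis by (simp add: chi_def)
qed

lemma chi_1 [simp]: "chi 1 = 1"
  by (simp add: chi_def Legendre_3 kronecker_prime_2)

lemma chi_power: "chi (a ^ n) = chi a ^ n"
  by (induction n) (simp_all add: chi_mult)

lemma chi_prod: "chi (prod f A) = (\<Prod>x\<in>A. chi (f x))"
  by (induction A rule: infinite_finite_induct) (simp_all add: chi_mult)

text \<open>The second supplement to quadratic reciprocity, by Gauss's lemma. With p = 2h + 1 the
  doubles 2x, x \<le> h, stay below p, and those exceeding h are the ones with x > h div 2. Their
  number h - h div 2 is even exactly for p congruent to 1 or 7 modulo 8.\<close>

lemma Legendre_2: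
  fixes p :: nat
  assumes "prime p" "2 < p"
  shows "Legendre 2 (int p) = kronecker_prime (int p) 2"
proof -
  interpret GAUSS p 2
  proof
    show "[2 \<noteq> 0] (mod int p)"
      using assms by (auto simp: cong_0_iff dest!: zdvd_imp_le)
  qed (use assms in auto)
  define h where "h = (int p - 1) div 2"
  have ph: "int p = 2 * h + 1" using p_eq2 by (simp add: h_def)
  have h: "h \<ge> 1" using ph assms by linarith
  have "C = (\<lambda>x. 2 * x) ` {1..h}"
    unfolding C_def B_def A_def image_image h_def[symmetric]
    by (rule image_cong) (auto simp: ph mod_pos_pos_trivial)
  then have "E = (\<lambda>x. 2 * x) ` {h div 2 + 1..h}"
    unfolding E_def h_def[symmetric] by (auto simp: image_iff)
  then have card: "card E = nat (h - h div 2)"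
    by (simp add: card_image inj_on_def)
  have "even (h - h div 2) \<longleftrightarrow> int p mod 8 = 1 \<or> int p mod 8 = 7"
    unfolding ph by presburger
  moreover have "h - h div 2 \<ge> 0" using h by simp
  ultimately have "even (card E) \<longleftrightarrow> int p mod 8 \<in> {1, 7}"
    unfolding card by (simp add: even_nat_iff)
  moreover have "odd (int p)" using odd_p by simp
  ultimately show ?thesis
    using gauss_lemma by (auto simp: kronecker_prime_2)
qed

lemma Legendre_cases: "Legendre a p \<in> {-1, 0, 1}"
  by (simp add: Legendre_def)

text \<open>Euler's criterion splits (-6)^h into (-1)^h 2^h 3^h, and (-1)^h is the sign by which
  reciprocity exchanges 3 and p. The resulting congruence is an equality because both sides have
  absolute value at most 1 and p > 3.\<close>

lemma Legendre_minus_6: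
  fixes p :: nat
  assumes "prime p" "3 < p"
  shows "Legendre (-6) (int p) = chi (int p)"
proof -
  define h where "h = (p - 1) div 2"
  have odd: "odd p" using assms prime_odd_nat by auto
  have crit: "[Legendre a (int p) = a ^ h] (mod int p)" for a
    unfolding h_def using assms by (intro euler_criterion) auto
  have np3: "\<not> 3 dvd p"
    using assms by (auto simp: prime_nat_iff)
  have "Legendre 3 (int p) * Legendre (int p) 3 = (-1) ^ h"
    using Quadratic_Reciprocity[of 3 p] assms by (simp add: h_def)
  moreover have L3: "Legendre (int p) 3 = 1 \<or> Legendre (int p) 3 = -1"
    using np3 by (auto simp: Legendre_3 mod_eq_0_iff_dvd) presburger
  ultimately have r: "(-1) ^ h * Legendre 3 (int p) = Legendre (int p) 3"
    by (cases "even h") auto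
  have "[Legendre (-6) (int p) = (-6) ^ h] (mod int p)" by (rule crit)
  also have "(-6 :: int) ^ h = (-1) ^ h * (2 ^ h * 3 ^ h)"
    by (simp flip: power_mult_distrib)
  also have "[(-1) ^ h * (2 ^ h * 3 ^ h) = (-1) ^ h * (Legendre 2 (int p) * Legendre 3 (int p))] (mod int p)"
    by (intro cong_mult cong_refl cong_sym[OF crit])
  also have "(-1) ^ h * (Legendre 2 (int p) * Legendre 3 (int p)) = chi (int p)"
    using r Legendre_2[of p] assms by (simp add: chi_def algebra_simps)
  finally have c: "[Legendre (-6) (int p) = chi (int p)] (mod int p)" .
  have "\<bar>chi (int p)\<bar> \<le> 1" 
    by (auto simp: chi_def Legendre_3 kronecker_prime_2)
  moreover have "\<bar>Legendre (-6) (int p)\<bar> \<le> 1" by (simp add: Legendre_def)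
  ultimately have "\<bar>Legendre (-6) (int p) - chi (int p)\<bar> < int p" using assms by linarith
  moreover have "int p dvd Legendre (-6) (int p) - chi (int p)" using c by (simp add: cong_iff_dvd_diff)
  ultimately show ?thesis
    using dvd_imp_le_int[of "Legendre (-6) (int p) - chi (int p)" "int p"] by fastforce
qed

lemma kronecker_prime_minus_6:
  assumes "prime (p :: int)"
  shows "kronecker_prime (-6) p = chi p"
proof -
  have "p > 1" using assms by (rule prime_gt_1_int)
  then consider "p = 2" | "p = 3" | "p > 3" by linarith
  then show ?thesis
  proof cases
    case 3
    then have "prime (nat p)" "3 < nat p" using assms by auto
    from Legendre_minus_6[OF this] 3 show ?thesis by (simp add: kronecker_prime_def)
  qed (auto simp: kronecker_prime_def chi_def Legendre_def cong_def)
qed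

text \<open>Both sides agree at primes, and \<open>chi\<close> is completely multiplicative, so the
  prime factorisation can be reassembled inside it.\<close>

lemma kronecker_minus_6:
  assumes "n > 0"
  shows "kronecker (-6) (int n) = chi (int n)"
proof -
  have "kronecker (-6) (int n) = (\<Prod>p\<in>prime_factors (int n). kronecker_prime (-6) p ^ multiplicity p (int n))"
    using assms by (simp add: kronecker_def)
  also have "\<dots> = (\<Prod>p\<in>prime_factors (int n). chi (p ^ multiplicity p (int n)))"
    by (rule prod.cong) (auto simp: kronecker_prime_minus_6 chi_power in_prime_factors_iff)
  also have "\<dots> = chi (\<Prod>p\<in>prime_factors (int n). p ^ multiplicity p (int n))"
    by (rule chi_prod[symmetric])
  also have "(\<Prod>p\<in>prime_factors (int n). p ^ multiplicity p (int n)) = int n"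
    using assms by (subst prod_prime_factors) auto
  finally show ?thesis .
qed

section \<open>Lambert series\<close>

lemma infsum_bilateral:
  fixes f :: "int \<Rightarrow> 'a :: banach"
  assumes "f summable_on UNIV"
  shows "infsum f UNIV = f 0 + (\<Sum>\<^sub>\<infinity>n\<in>{1::nat..}. f (int n) + f (- int n))"
proof -
  have s: "f summable_on S" for S using summable_on_subset_banach[OF assms] by blast
  have 1: "(\<lambda>n. f (int n)) summable_on {1..}" "(\<Sum>\<^sub>\<infinity>n\<in>{1..}. f (int n)) = infsum f {0<..}"
    using s[of "{0<..}"]
      summable_on_reindex_bij_witness[of "{1..}" nat int "{0<..}" f "\<lambda>n. f (int n)"]
      infsum_reindex_bij_witness[of "{1..}" nat int "{0<..}" f "\<lambda>n. f (int n)"] by auto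
  have 2: "(\<lambda>n. f (- int n)) summable_on {1..}" "(\<Sum>\<^sub>\<infinity>n\<in>{1..}. f (- int n)) = infsum f {..<0}"
    using s[of "{..<0}"]
      summable_on_reindex_bij_witness[of "{1..}" "\<lambda>k. nat (- k)" "\<lambda>n. - int n" "{..<0}" f "\<lambda>n. f (- int n)"]
      infsum_reindex_bij_witness[of "{1..}" "\<lambda>k. nat (- k)" "\<lambda>n. - int n" "{..<0}" f "\<lambda>n. f (- int n)"] by auto
  have "UNIV = {0} \<union> ({0<..} \<union> {..<0 :: int})" by auto
  then have "infsum f UNIV = infsum f ({0} \<union> ({0<..} \<union> {..<0}))" by simp
  also have "\<dots> = f 0 + (infsum f {0<..} + infsum f {..<0})"
    by (subst infsum_Un_disjoint | simp add: s | fastforce)+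
  also have "infsum f {0<..} + infsum f {..<0} = (\<Sum>\<^sub>\<infinity>n\<in>{1::nat..}. f (int n) + f (- int n))"
    using 1 2 by (simp add: infsum_add)
  finally show ?thesis .
qed

lemma power_neq_minus_one:
  fixes q :: complex
  assumes "norm q < 1" "n > 0"
  shows "1 + q ^ n \<noteq> 0" "1 - q ^ n \<noteq> 0"
proof -
  have "norm (q ^ n) < 1" using assms by (simp add: norm_power power_less_one_iff)
  then have "q ^ n \<noteq> 1" "q ^ n \<noteq> - 1" by (metis norm_one less_irrefl, metis norm_minus_cancel norm_one less_irrefl)
  then show "1 + q ^ n \<noteq> 0" "1 - q ^ n \<noteq> 0" by (auto simp: add_eq_0_iff)
qed

lemma norm_one_minus_power_ge:
  fixes q :: complex
  assumes "norm q < 1" "n > 0"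
  shows "norm (1 - q ^ n) \<ge> 1 - norm q" "norm (1 + q ^ n) \<ge> 1 - norm q"
proof -
  have "norm (q ^ n) \<le> norm q"
    using assms power_decreasing[of 1 n "norm q"] by (simp add: norm_power)
  moreover have "norm (1 - q ^ n) \<ge> norm (1::complex) - norm (q ^ n)" by (rule norm_triangle_ineq2)
  moreover have "norm (1 - (- (q ^ n))) \<ge> norm (1::complex) - norm (- (q ^ n))" by (rule norm_triangle_ineq2)
  ultimately show "norm (1 - q ^ n) \<ge> 1 - norm q" "norm (1 + q ^ n) \<ge> 1 - norm q" by auto
qed

lemma summable_on_geometric_from_1:
  assumes "norm (q :: complex) < 1"
  shows "(\<lambda>n. c * norm q ^ n) summable_on {1..}"
proof -
  have "((\<lambda>n. norm q ^ n) has_sum (norm q / (1 - norm q))) {1..}"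
    using assms by (intro has_sum_geometric_from_1) auto
  then show ?thesis by (intro summable_on_cmult_right has_sum_imp_summable)
qed

lemma lambert_summable:
  fixes q :: complex
  assumes q: "norm q < 1" and c: "\<And>n. norm (c n :: complex) \<le> 1"
  shows "(\<lambda>n. c n * (q ^ n / (1 - q ^ n))) summable_on {1..}"
proof (rule abs_summable_summable, rule summable_on_comparison_test)
  show "(\<lambda>n. 1 / (1 - norm q) * norm q ^ n) summable_on {1..}"
    by (rule summable_on_geometric_from_1[OF q])
  fix n :: nat assume n: "n \<in> {1..}"
  have "norm (c n * (q ^ n / (1 - q ^ n))) \<le> 1 * (norm q ^ n / (1 - norm q))"
    unfolding norm_mult norm_divide norm_power
    using n q by (intro mult_mono frac_le norm_one_minus_power_ge c) auto
  then show "norm (c n * (q ^ n / (1 - q ^ n))) \<le> 1 / (1 - norm q) * norm q ^ n" by simp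
qed auto

text \<open>Both sides are iterated sums of c(m) q^(mn). Summing over \<open>n\<close> first is a
  geometric series; absolute convergence follows from |q|^m / (1 - |q|^m) \<le> |q|^m / (1 -
  |q|).\<close>

lemma lambert_swap:
  fixes q :: complex
  assumes q: "norm q < 1" and c: "\<And>n. norm (c n :: complex) \<le> 1"
  shows "(\<Sum>\<^sub>\<infinity>n\<in>{1..}. \<Sum>\<^sub>\<infinity>m\<in>{1..}. c m * (q ^ n) ^ m) = (\<Sum>\<^sub>\<infinity>m\<in>{1::nat..}. c m * (q ^ m / (1 - q ^ m)))"
proof -
  have nq: "norm (q ^ m) < 1" if "m \<ge> 1" for m
    using q that by (simp add: norm_power power_less_one_iff)
  have geo: "((\<lambda>n. norm q ^ (m * n)) has_sum (norm q ^ m / (1 - norm q ^ m))) {1..}" if "m \<ge> 1" for m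
    using has_sum_geometric_from_1[of "norm q ^ m"] nq[OF that] by (simp add: norm_power power_mult)
  have "(\<lambda>(m, n). q ^ (m * n)) summable_on {1..} \<times> {1..}"
  proof (rule abs_summable_summable, rule Infinite_Sum.abs_summable_on_Sigma_iff[THEN iffD2], intro conjI ballI)
    fix m :: nat assume "m \<in> {1..}"
    then show "(\<lambda>n. norm (case (m, n) of (m, n) \<Rightarrow> q ^ (m * n))) summable_on {1..}"
      using geo[of m] by (auto simp: norm_power has_sum_imp_summable)
  next
    show "(\<lambda>m. norm (\<Sum>\<^sub>\<infinity>n\<in>{1..}. norm (case (m, n) of (m, n) \<Rightarrow> q ^ (m * n)))) summable_on {1..}"
    proof (rule summable_on_comparison_test)
      show "(\<lambda>n. 1 / (1 - norm q) * norm q ^ n) summable_on {1..}"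
        by (rule summable_on_geometric_from_1[OF q])
      fix m :: nat assume m: "m \<in> {1..}"
      have "norm q ^ m \<le> norm q" using m q power_decreasing[of 1 m "norm q"] by simp
      then have "norm q ^ m / (1 - norm q ^ m) \<le> norm q ^ m / (1 - norm q)"
        using q by (intro frac_le) auto
      moreover have "\<bar>1 - norm q ^ m\<bar> = 1 - norm q ^ m"
        using nq[of m] m by (simp add: norm_power)
      ultimately show "norm (\<Sum>\<^sub>\<infinity>n\<in>{1..}. norm (case (m, n) of (m, n) \<Rightarrow> q ^ (m * n))) \<le> 1 / (1 - norm q) * norm q ^ m"
        using infsumI[OF geo[of m]] m by (simp add: norm_power)
    qed auto
  qed
  then have s: "(\<lambda>z. norm (case z of (m, n) \<Rightarrow> q ^ (m * n))) summable_on {1..} \<times> {1..}"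
    by (rule summable_on_iff_abs_summable_on_complex[THEN iffD1])
  have "(\<lambda>(m, n). c m * q ^ (m * n)) summable_on {1..} \<times> {1..}"
  proof (rule abs_summable_summable, rule summable_on_comparison_test[OF s])
    fix z :: "nat \<times> nat"
    show "norm (case z of (m, n) \<Rightarrow> c m * q ^ (m * n)) \<le> norm (case z of (m, n) \<Rightarrow> q ^ (m * n))"
      using c by (auto simp: norm_mult split: prod.splits intro!: mult_left_le_one_le)
  qed auto
  then have "(\<Sum>\<^sub>\<infinity>m\<in>{1..}. \<Sum>\<^sub>\<infinity>n\<in>{1..}. c m * q ^ (m * n)) = (\<Sum>\<^sub>\<infinity>n\<in>{1..}. \<Sum>\<^sub>\<infinity>m\<in>{1..}. c m * q ^ (m * n))"
    by (rule infsum_swap_banach)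
  moreover have "(\<Sum>\<^sub>\<infinity>n\<in>{1..}. c m * q ^ (m * n)) = c m * (q ^ m / (1 - q ^ m))" if "m \<ge> 1" for m
    using infsumI[OF has_sum_geometric_from_1[OF nq[OF that]]] by (simp add: infsum_cmult_right' power_mult)
  then have "(\<Sum>\<^sub>\<infinity>m\<in>{1..}. \<Sum>\<^sub>\<infinity>n\<in>{1..}. c m * q ^ (m * n)) = (\<Sum>\<^sub>\<infinity>m\<in>{1..}. c m * (q ^ m / (1 - q ^ m)))"
    by (intro infsum_cong) auto
  ultimately show ?thesis
    by (simp add: power_mult[symmetric] mult.commute)
qed

lemma norm_chi_le: "norm (of_int (chi n) :: complex) \<le> 1"
proof -
  have "chi n \<in> {-1, 0, 1}"
    using Legendre_cases[of n 3] by (auto simp: chi_def kronecker_prime_2)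
  then show ?thesis by auto
qed

text \<open>12 is 0 modulo 3 and 4 modulo 8, and adding 4 exchanges the classes 1, 7 with the
  classes 5, 3 modulo 8.\<close>

lemma chi_plus_12: "chi (n + 12) = - chi n"
proof -
  have "(n + 12) mod 3 = n mod 3" by presburger
  then have "Legendre (n + 12) 3 = Legendre n 3" by (simp only: Legendre_3)
  moreover have "kronecker_prime (n + 12) 2 = - kronecker_prime n 2"
  proof (cases "even n")
    case False
    then have "(n + 12) mod 8 \<in> {1, 7} \<longleftrightarrow> n mod 8 \<notin> {1, 7}"
      unfolding insert_iff empty_iff by presburger
    moreover have "odd (n + 12)" using False by simp
    ultimately show ?thesis using False unfolding kronecker_prime_2 by (simp only: if_False if_not_P) auto
  qed (simp add: kronecker_prime_2)
  ultimately show ?thesis by (simp add: chi_def)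
qed

text \<open>The series is summed by its sign change under a shift by 12, half of the period.\<close>

lemma chi_generating_function:
  fixes y :: complex
  assumes y: "norm y < 1"
  shows "(\<Sum>\<^sub>\<infinity>m\<in>{1..}. of_int (chi (int m)) * y ^ m) = (y + y ^ 5 + y ^ 7 + y ^ 11) / (1 + y ^ 12)"
proof -
  define f where "f m = of_int (chi (int m)) * y ^ m" for m
  have "summable (\<lambda>n. norm y ^ n)" using y by (intro summable_geometric) auto
  then have sn: "summable (\<lambda>n. norm (f n))"
    by (rule summable_comparison_test'[where N = 0])
       (use norm_chi_le in \<open>auto simp: f_def norm_mult norm_power intro!: mult_left_le_one_le\<close>)
  then have s: "summable f" by (rule summable_norm_cancel)
  have "f (n + 12) = - (y ^ 12 * f n)" for n
    using chi_plus_12[of "int n"] by (simp add: f_def power_add)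
  then have "suminf f = - (y ^ 12 * suminf f) + (\<Sum>n<12. f n)"
    using suminf_split_initial_segment[OF s, of 12] s by (simp add: suminf_minus suminf_mult summable_mult)
  \<comment> \<open>The character has the value 1 at each of the numbers 1, 5, 7, 11, the only ones
    below 12 prime to 6.\<close>
  also have "(\<Sum>n<12. f n) = y + y ^ 5 + y ^ 7 + y ^ 11"
  proof -
    have "{..<12} = {0, 1, 2, 3, 4, 5, 6, 7, 8, 9, 10, 11 :: nat}" by (simp add: lessThan_nat_numeral lessThan_Suc insert_commute)
    then show ?thesis by (simp add: f_def chi_def Legendre_3 kronecker_prime_2)
  qed
  finally have "(1 + y ^ 12) * suminf f = y + y ^ 5 + y ^ 7 + y ^ 11" by (simp add: algebra_simps)
  then have "suminf f = (y + y ^ 5 + y ^ 7 + y ^ 11) / (1 + y ^ 12)"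
    using power_neq_minus_one[OF y, of 12] by (simp add: field_simps)
  moreover have "infsum f UNIV = suminf f"
    using norm_summable_imp_has_sum[OF sn summable_sums[OF s]] by (rule infsumI)
  moreover have "infsum f {1..} = infsum f UNIV"
  proof (rule infsum_cong_neutral)
    fix n :: nat assume "n \<in> UNIV - {1..}"
    then show "f n = 0" by (simp add: f_def chi_def Legendre_3 not_le)
  qed auto
  ultimately show ?thesis unfolding f_def[symmetric] by simp
qed

section \<open>Bilateral series as Lambert series, and their behaviour under s to -s\<close>

lemma power_int_numeral_mult_nat: "q powi (numeral k * int n) = (q ^ n) ^ numeral k"
  for q :: "'a :: division_ring"
  by (metis mult.commute of_nat_mult of_nat_numeral power_int_of_nat power_mult)

text \<open>The terms at n and -n together are a rational function of y = q^n, namely the generating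
  function of \<open>chi\<close> at y. The term at n = 0 is 2/2 = 1.\<close>

lemma bilateral_P_lambert:
  fixes q :: complex
  assumes q: "norm q < 1" "q \<noteq> 0"
    and s: "(\<lambda>n::int. (q powi n + q powi (5 * n)) / (1 + q powi (12 * n))) summable_on UNIV"
  shows "(\<Sum>\<^sub>\<infinity>n\<in>(UNIV::int set). (q powi n + q powi (5 * n)) / (1 + q powi (12 * n))) =
    1 + (\<Sum>\<^sub>\<infinity>n\<in>{1::nat..}. of_int (chi (int n)) * (q ^ n / (1 - q ^ n)))"
proof -
  have "(q powi int n + q powi (5 * int n)) / (1 + q powi (12 * int n)) +
      (q powi (- int n) + q powi (5 * - int n)) / (1 + q powi (12 * - int n)) =
      (\<Sum>\<^sub>\<infinity>m\<in>{1..}. of_int (chi (int m)) * (q ^ n) ^ m)" if "n \<in> {1..}" for n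
  proof -
    define y where "y = q ^ n"
    have y: "norm y < 1" "y \<noteq> 0"
      using q that by (auto simp: y_def norm_power power_less_one_iff)
    have e: "q powi (k * int n) = y powi k" for k
      by (simp add: y_def power_int_power mult.commute)
    have "1 + y ^ 12 \<noteq> 0" using power_neq_minus_one[OF y(1), of 12] by simp
    moreover from this have "1 + y powi (-12) \<noteq> 0"
      using y(2) by (simp add: power_int_minus field_simps)
    ultimately have "(y + y ^ 5) / (1 + y ^ 12) + (y powi (-1) + y powi (-5)) / (1 + y powi (-12)) =
       (y + y ^ 5 + y ^ 7 + y ^ 11) / (1 + y ^ 12)"
      using y(2) by (simp add: power_int_minus divide_simps) (simp add: algebra_simps flip: power_add power_Suc)
    then show ?thesis
      using e[of 1] e[of 5] e[of 12] e[of "-1"] e[of "-5"] e[of "-12"] chi_generating_function[OF y(1)]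
      by (simp add: y_def[symmetric])
  qed
  then have "(\<Sum>\<^sub>\<infinity>n\<in>{1..}. (q powi int n + q powi (5 * int n)) / (1 + q powi (12 * int n)) +
      (q powi (- int n) + q powi (5 * - int n)) / (1 + q powi (12 * - int n))) =
      (\<Sum>\<^sub>\<infinity>n\<in>{1..}. \<Sum>\<^sub>\<infinity>m\<in>{1..}. of_int (chi (int m)) * (q ^ n) ^ m)"
    by (rule infsum_cong)
  then show ?thesis
    unfolding infsum_bilateral[OF s]
      lambert_swap[OF q(1), of "\<lambda>m. of_int (chi (int m))", OF norm_chi_le, symmetric]
    by simp
qed

definition lambert_h :: "complex \<Rightarrow> complex" where
  "lambert_h y = y * (1 - y\<^sup>2) / (1 + y ^ 4)"

text \<open>The summand is an odd function of m = 3n + 1. As n runs over the integers, |m| runs once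
  through the positive integers prime to 3, and the sign of m is the Legendre symbol of |m|.\<close>

lemma bilateral_Q_lambert:
  fixes q :: complex
  assumes q: "norm q < 1" "q \<noteq> 0"
  shows "(\<Sum>\<^sub>\<infinity>n\<in>(UNIV::int set). (q powi (3 * n + 1) - q powi (9 * n + 3)) / (1 + q powi (12 * n + 4))) =
    (\<Sum>\<^sub>\<infinity>n\<in>{1::nat..}. of_int (Legendre (int n) 3) * lambert_h (q ^ n))"
proof -
  define f where "f m = (q powi m - q powi (3 * m)) / (1 + q powi (4 * m))" for m :: int
  have fpos: "f (int n) = lambert_h (q ^ n)" for n
    unfolding f_def lambert_h_def power_int_numeral_mult_nat power_int_of_nat
    by (simp add: algebra_simps power2_eq_square power3_eq_cube)
  have fneg: "f (- m) = - f m" if "m \<noteq> 0" for m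
  proof -
    define y where "y = q powi m"
    have y: "y \<noteq> 0" using q by (simp add: y_def)
    have "1 + q ^ (4 * nat \<bar>m\<bar>) \<noteq> 0"
      using power_neq_minus_one[OF q(1), of "4 * nat \<bar>m\<bar>"] that by simp
    then have "1 + q powi (4 * \<bar>m\<bar>) \<noteq> 0" by (simp add: power_int_def nat_mult_distrib)
    then have "1 + q powi (4 * m) \<noteq> 0"
      using q by (cases "m \<ge> 0") (auto simp: power_int_minus field_simps)
    moreover have e: "q powi (k * m) = y powi k" for k
      by (simp add: y_def power_int_mult[symmetric] mult.commute)
    ultimately have y4: "1 + y ^ 4 \<noteq> 0" by simp
    have "1 + y powi (-4) \<noteq> 0" using y4 y by (simp add: power_int_minus field_simps)
    then have "(y powi (-1) - y powi (-3)) / (1 + y powi (-4)) = - ((y - y ^ 3) / (1 + y ^ 4))"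
      using y y4 by (simp add: power_int_minus divide_simps) (simp add: algebra_simps flip: power_add power_Suc)
    then show ?thesis
      using e[of 1] e[of 3] e[of 4] e[of "-1"] e[of "-3"] e[of "-4"] by (simp add: f_def)
  qed
  have "(\<Sum>\<^sub>\<infinity>n\<in>(UNIV::int set). (q powi (3 * n + 1) - q powi (9 * n + 3)) / (1 + q powi (12 * n + 4))) =
     (\<Sum>\<^sub>\<infinity>n\<in>(UNIV::int set). f (3 * n + 1))"
    by (simp add: f_def algebra_simps)
  \<comment> \<open>For k congruent to 1 modulo 3 the preimage is nonnegative; for k congruent to 2
    one has k = -(3n + 1) with n = -(k + 1)/3.\<close>
  also have "\<dots> = (\<Sum>\<^sub>\<infinity>k\<in>{k::nat. \<not> 3 dvd k}. of_int (Legendre (int k) 3) * lambert_h (q ^ k))"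
  proof (rule infsum_reindex_bij_witness[of _
        "\<lambda>k. if k mod 3 = 1 then int k div 3 else - ((int k + 1) div 3)" "\<lambda>n. nat \<bar>3 * n + 1\<bar>"])
    fix n :: int
    show "(if nat \<bar>3 * n + 1\<bar> mod 3 = 1 then int (nat \<bar>3 * n + 1\<bar>) div 3
       else - ((int (nat \<bar>3 * n + 1\<bar>) + 1) div 3)) = n"
    proof (cases "n \<ge> 0")
      case True
      then have "nat \<bar>3 * n + 1\<bar> = 3 * nat n + 1" by linarith
      with True show ?thesis by simp
    next
      case False
      then obtain m where m: "n = - int m - 1" by (intro that[of "nat (- n - 1)"]) simp
      then have "nat \<bar>3 * n + 1\<bar> = 3 * m + 2" by linarith
      moreover have "(3 * m + 2) mod 3 = 2" by presburger
      moreover have "int (3 * m + 2) + 1 = 3 * (int m + 1)" by simp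
      ultimately show ?thesis by (simp only: m) simp
    qed
    have "\<not> 3 dvd 3 * n + 1" by presburger
    then show "nat \<bar>3 * n + 1\<bar> \<in> {k. \<not> 3 dvd k}"
      by (simp add: nat_dvd_iff nat_abs_dvd_iff dvd_nat_abs_iff)
    show "of_int (Legendre (int (nat \<bar>3 * n + 1\<bar>)) 3) * lambert_h (q ^ nat \<bar>3 * n + 1\<bar>) = f (3 * n + 1)"
    proof (cases "n \<ge> 0")
      case True
      then have "Legendre (3 * n + 1) 3 = 1" by (simp add: Legendre_3)
      with True fpos[of "nat (3 * n + 1)"] show ?thesis by simp
    next
      case False
      have "(- (3 * n + 1)) mod 3 = 2" by presburger
      then have "Legendre (- (3 * n + 1)) 3 = -1" unfolding Legendre_3 by simp
      with False fpos[of "nat (- (3 * n + 1))"] fneg[of "- (3 * n + 1)"] show ?thesis by (simp add: add.commute)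
    qed
  next
    fix k :: nat assume "k \<in> {k. \<not> 3 dvd k}"
    then have k: "\<not> 3 dvd k" by simp
    show "nat \<bar>3 * (if k mod 3 = 1 then int k div 3 else - ((int k + 1) div 3)) + 1\<bar> = k"
    proof (cases "k mod 3 = 1")
      case True
      then obtain j where "k = 3 * j + 1" by (metis mult_div_mod_eq)
      then show ?thesis by simp
    next
      case False
      then have "k mod 3 = 2" using k by presburger
      then obtain j where "k = 3 * j + 2" by (metis mult_div_mod_eq)
      then show ?thesis unfolding if_not_P[OF False] by simp
    qed
  qed auto
  also have "\<dots> = (\<Sum>\<^sub>\<infinity>n\<in>{1::nat..}. of_int (Legendre (int n) 3) * lambert_h (q ^ n))"
  proof (rule infsum_cong_neutral)
    fix k :: nat assume "k \<in> {1..} - {k. \<not> 3 dvd k}"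
    then have "int k mod 3 = 0" by (auto simp flip: of_nat_mod)
    then show "of_int (Legendre (int k) 3) * lambert_h (q ^ k) = 0" by (simp add: Legendre_3)
  next
    fix k :: nat assume "k \<in> {k. \<not> 3 dvd k} - {1..}"
    then show "of_int (Legendre (int k) 3) * lambert_h (q ^ k) = 0" by (cases k) auto
  qed auto
  finally show ?thesis .
qed

lemma lambert_h_summable:
  fixes q :: complex
  assumes q: "norm q < 1"
  shows "(\<lambda>n. of_int (Legendre (int n) 3) * lambert_h (q ^ n)) summable_on {1::nat..}"
proof (rule abs_summable_summable, rule summable_on_comparison_test)
  show "(\<lambda>n. 2 / (1 - norm q) * norm q ^ n) summable_on {1..}"
    by (rule summable_on_geometric_from_1[OF q])
  fix n :: nat assume n: "n \<in> {1..}"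
  have "norm (1 - (q ^ n)\<^sup>2) \<le> 1 + norm ((q ^ n)\<^sup>2)"
    using norm_triangle_ineq4[of 1 "(q ^ n)\<^sup>2"] by simp
  also have "norm ((q ^ n)\<^sup>2) \<le> 1"
    using q by (auto simp: norm_power intro!: power_le_one)
  finally have 1: "norm (1 - (q ^ n)\<^sup>2) \<le> 2" by simp
  have 2: "norm (of_int (Legendre (int n) 3) :: complex) \<le> 1"
    using Legendre_cases[of "int n" 3] by auto
  have "norm (of_int (Legendre (int n) 3) * lambert_h (q ^ n)) \<le> 1 * (norm q ^ n * 2 / (1 - norm q))"
    unfolding norm_mult norm_divide lambert_h_def norm_power[of q n, symmetric]
    using norm_one_minus_power_ge(2)[OF q, of "n * 4"] n q
    by (intro mult_mono frac_le 1 2) (auto simp: power_mult)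
  then show "norm (of_int (Legendre (int n) 3) * lambert_h (q ^ n)) \<le> 2 / (1 - norm q) * norm q ^ n"
    by (simp add: mult.commute)
qed auto

text \<open>Even \<open>n\<close> contribute nothing, and for odd \<open>n\<close> the two terms
  combine by y/(1 - y) - y/(1 + y) = 2 y^2/(1 - y^2).\<close>

lemma lambert_chi_double:
  fixes s :: complex
  assumes s: "norm s < 1"
  defines "L \<equiv> \<lambda>q::complex. \<Sum>\<^sub>\<infinity>n\<in>{1::nat..}. of_int (chi (int n)) * (q ^ n / (1 - q ^ n))"
  shows "L s + L (- s) = 2 * L (s\<^sup>2)"
proof -
  have "L s + L (- s) = (\<Sum>\<^sub>\<infinity>n\<in>{1::nat..}. of_int (chi (int n)) * (s ^ n / (1 - s ^ n)) +
      of_int (chi (int n)) * ((- s) ^ n / (1 - (- s) ^ n)))"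
    unfolding L_def by (rule infsum_add[symmetric]) (use s in \<open>intro lambert_summable norm_chi_le; simp\<close>)+
  also have "\<dots> = (\<Sum>\<^sub>\<infinity>n\<in>{1::nat..}. 2 * (of_int (chi (int n)) * ((s\<^sup>2) ^ n / (1 - (s\<^sup>2) ^ n))))"
  proof (rule infsum_cong)
    fix n :: nat assume n: "n \<in> {1..}"
    show "of_int (chi (int n)) * (s ^ n / (1 - s ^ n)) + of_int (chi (int n)) * ((- s) ^ n / (1 - (- s) ^ n)) =
      2 * (of_int (chi (int n)) * ((s\<^sup>2) ^ n / (1 - (s\<^sup>2) ^ n)))"
    proof (cases "even n")
      case True
      then have "chi (int n) = 0" by (simp add: chi_def kronecker_prime_2)
      then show ?thesis by simp
    next
      case False
      define y where "y = s ^ n"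
      have y: "1 - y \<noteq> 0" "1 + y \<noteq> 0" using power_neq_minus_one[OF s, of n] n by (auto simp: y_def)
      have "(1 - y) * (1 + y) \<noteq> 0" using y by simp
      then have y2: "1 - y\<^sup>2 \<noteq> 0" by (simp add: algebra_simps power2_eq_square)
      have "y / (1 - y) + (- y) / (1 + y) = 2 * (y\<^sup>2 / (1 - y\<^sup>2))"
        using y y2 by (simp add: divide_simps) (simp add: algebra_simps power2_eq_square)
      then have "c * (y / (1 - y)) + c * ((- y) / (1 - - y)) = 2 * (c * (y\<^sup>2 / (1 - y\<^sup>2)))" for c
        by (metis diff_minus_eq_add distrib_left mult.left_commute)
      moreover have "(- s) ^ n = - y" "(s\<^sup>2) ^ n = y\<^sup>2"
        using False by (auto simp: y_def power_mult[symmetric] mult.commute)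
      ultimately show ?thesis by (simp only: y_def[symmetric])
    qed
  qed
  also have "\<dots> = 2 * L (s\<^sup>2)"
    unfolding L_def by (rule infsum_cmult_right')
  finally show ?thesis .
qed

text \<open>Since \<open>lambert_h\<close> is odd, the terms with odd \<open>n\<close> cancel. At n
  = 2m the two terms coincide, and the symbol of 2m is the negative of that of m; hence the factor
  -2.\<close>

lemma lambert_h_double:
  fixes s :: complex
  assumes s: "norm s < 1"
  defines "L \<equiv> \<lambda>q::complex. \<Sum>\<^sub>\<infinity>n\<in>{1::nat..}. of_int (Legendre (int n) 3) * lambert_h (q ^ n)"
  shows "L s + L (- s) = - 2 * L (s\<^sup>2)"
proof -
  define g where "g n = of_int (Legendre (int n) 3) * lambert_h (s ^ n) +
      of_int (Legendre (int n) 3) * lambert_h ((- s) ^ n)" for n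
  have "L s + L (- s) = (\<Sum>\<^sub>\<infinity>n\<in>{1::nat..}. g n)"
    unfolding L_def g_def by (rule infsum_add[symmetric]) (use s in \<open>intro lambert_h_summable; simp\<close>)+
  also have "\<dots> = (\<Sum>\<^sub>\<infinity>n\<in>{n::nat. n \<ge> 1 \<and> even n}. g n)"
    by (rule infsum_cong_neutral) (auto simp: g_def lambert_h_def)
  also have "\<dots> = (\<Sum>\<^sub>\<infinity>n\<in>{1::nat..}. - 2 * (of_int (Legendre (int n) 3) * lambert_h ((s\<^sup>2) ^ n)))"
  proof (rule infsum_reindex_bij_witness[of _ "\<lambda>n. 2 * n" "\<lambda>n. n div 2"])
    fix n :: nat assume "n \<in> {n. n \<ge> 1 \<and> even n}"
    then obtain m where m: "n = 2 * m" "m \<ge> 1" by (auto elim!: evenE)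
    have "int m mod 3 = 0 \<or> int m mod 3 = 1 \<or> int m mod 3 = 2" by presburger
    moreover have "2 * int m mod 3 = 2 * (int m mod 3) mod 3" by (rule mod_mult_right_eq[symmetric])
    ultimately have "Legendre (2 * int m) 3 = - Legendre (int m) 3"
      unfolding Legendre_3 by (elim disjE) simp_all
    then show "- 2 * (of_int (Legendre (int (n div 2)) 3) * lambert_h ((s\<^sup>2) ^ (n div 2))) = g n"
      by (simp add: g_def m power_mult)
  qed auto
  also have "\<dots> = - 2 * L (s\<^sup>2)"
    unfolding L_def by (rule infsum_cmult_right')
  finally show ?thesis .
qed

section \<open>Theta functions at level 24\<close>

text \<open>Theta without its factor \<open>euler_E p\<close>. In this form theta values are
  products over residue classes and can be multiplied without extra factors.\<close>

definition tprod :: "complex \<Rightarrow> complex \<Rightarrow> complex" where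
  "tprod p z = qpoch z p * qpoch (p / z) p"

lemma theta_eq_tprod:
  assumes "norm p < 1" "p \<noteq> 0" "z \<noteq> 0"
  shows "theta p z = euler_E p * tprod p z"
  using jacobi_triple_product[OF assms] by (simp add: tprod_def euler_E_eq_qpoch)

lemma euler_E_nonzero: "norm x < 1 \<Longrightarrow> euler_E x \<noteq> 0"
  by (simp add: euler_E_eq_qpoch qpoch_nonzero_norm)

lemma norm_power_less_one: "norm (x :: complex) < 1 \<Longrightarrow> n > 0 \<Longrightarrow> norm (x ^ n) < 1"
  by (simp add: norm_power power_less_one_iff)

lemma tprod_mult_minus:
  assumes "norm p < 1"
  shows "tprod p z * tprod p (- z) = tprod (p\<^sup>2) (z\<^sup>2)"
  using qpoch_mult_minus[OF assms, of z] qpoch_mult_minus[OF assms, of "p / z"]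
  by (simp add: tprod_def power_divide mult_ac)

text \<open>Sorting the factors on the right by the parity of the exponent. With p = q^6 it merges
  the arguments q and q^5 at nome q^12, whose theta values are evaluated only as a product.\<close>

lemma tprod_split:
  assumes "norm p < 1" "p \<noteq> 0"
  shows "tprod (p\<^sup>2) z * tprod (p\<^sup>2) (p / z) = tprod p z"
proof -
  have q2: "qpoch a p = qpoch a (p\<^sup>2) * qpoch (a * p) (p\<^sup>2)" for a
    using qpoch_dissect[OF assms(1), of 2 a] by (simp add: eval_nat_numeral)
  have "p\<^sup>2 / (p / z) = z * p" "p / z * p = p\<^sup>2 / z"
    using assms by (auto simp: power2_eq_square)
  then show ?thesis
    unfolding tprod_def q2[of z] q2[of "p / z"] by (simp only: mult_ac)
qed

lemma euler_E_dissect: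
  assumes "norm x < 1" "m > 0" "k > 0"
  shows "euler_E (x ^ k) = (\<Prod>r\<in>{1..m}. qpoch (x ^ (k * r)) (x ^ (k * m)))"
proof -
  have "euler_E (x ^ k) = (\<Prod>r<m. qpoch (x ^ k * (x ^ k) ^ r) ((x ^ k) ^ m))"
    unfolding euler_E_eq_qpoch
    by (rule qpoch_dissect[OF norm_power_less_one[OF assms(1,3)] assms(2)])
  also have "\<dots> = (\<Prod>r<m. qpoch (x ^ (k * Suc r)) (x ^ (k * m)))"
    by (simp only: power_mult power_Suc)
  also have "\<dots> = (\<Prod>r\<in>{1..m}. qpoch (x ^ (k * r)) (x ^ (k * m)))"
    by (rule prod.reindex_bij_witness[of _ "\<lambda>r. r - 1" Suc]) auto
  finally show ?thesis .
qed

lemma atLeast1_atMost_numeral: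
  "{1..2} = {1, 2 :: nat}" "{1..3} = {1, 2, 3 :: nat}" "{1..4} = {1, 2, 3, 4 :: nat}"
  "{1..6} = {1, 2, 3, 4, 5, 6 :: nat}"
  by auto

lemma tprod_2:
  assumes "norm x < 1" "x \<noteq> 0"
  shows "tprod (x\<^sup>2) x * euler_E (x\<^sup>2) ^ 2 = euler_E x ^ 2"
proof -
  have "x\<^sup>2 / x = x" using assms by (simp add: power2_eq_square)
  then show ?thesis
    using euler_E_dissect[OF assms(1), of 2 1] euler_E_dissect[OF assms(1), of 1 2]
    unfolding atLeast1_atMost_numeral
    by (simp add: tprod_def power_mult_distrib) (simp add: power2_eq_square mult_ac)
qed

lemma tprod_3:
  assumes "norm x < 1" "x \<noteq> 0"
  shows "tprod (x ^ 3) x * euler_E (x ^ 3) = euler_E x"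
proof -
  have "x ^ 3 / x = x ^ 2" using assms by (simp add: eval_nat_numeral)
  then show ?thesis
    using euler_E_dissect[OF assms(1), of 3 1] euler_E_dissect[OF assms(1), of 1 3]
    unfolding atLeast1_atMost_numeral by (simp add: tprod_def)
qed

lemma tprod_4:
  assumes "norm x < 1" "x \<noteq> 0"
  shows "tprod (x ^ 4) x * euler_E (x\<^sup>2) = euler_E x"
proof -
  have "x ^ 4 / x = x ^ 3" using assms by (simp add: eval_nat_numeral)
  then show ?thesis
    using euler_E_dissect[OF assms(1), of 4 1] euler_E_dissect[OF assms(1), of 2 2]
    unfolding atLeast1_atMost_numeral by (simp add: tprod_def)
qed

text \<open>The classes 1 and 5 are those prime to 6, so this is inclusion and exclusion: all
  exponents, without the multiples of 2 and of 3, with the multiples of 6 restored.\<close>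

lemma tprod_6:
  assumes "norm x < 1" "x \<noteq> 0"
  shows "tprod (x ^ 6) x * (euler_E (x\<^sup>2) * euler_E (x ^ 3)) = euler_E x * euler_E (x ^ 6)"
proof -
  have "x ^ 6 / x = x ^ 5" using assms by (simp add: eval_nat_numeral)
  then show ?thesis
    using euler_E_dissect[OF assms(1), of 6 1] euler_E_dissect[OF assms(1), of 3 2] euler_E_dissect[OF assms(1), of 2 3] euler_E_dissect[OF assms(1), of 1 6]
    unfolding atLeast1_atMost_numeral by (simp add: tprod_def)
qed

text \<open>The 2 is the initial factor 1 - (-1) of (-1;p); what remains is the square of
  (-p;p).\<close>

lemma tprod_minus_one:
  assumes "norm p < 1"
  shows "tprod p (- 1) * euler_E p ^ 2 = 2 * euler_E (p\<^sup>2) ^ 2"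
proof -
  have "qpoch (- 1) p = 2 * qpoch (- p) p"
    using qpoch_rec[OF assms, of "- 1"] by simp
  then have "tprod p (- 1) * euler_E p ^ 2 = 2 * (qpoch p p * qpoch (- p) p) ^ 2"
    by (simp add: tprod_def euler_E_eq_qpoch power2_eq_square mult_ac)
  then show ?thesis
    by (simp add: qpoch_mult_minus[OF assms] euler_E_eq_qpoch)
qed

text \<open>Separation by the parity of the index; tri (2j) = 4 tri j + j accounts for the nome p^4.
  With p = q^3 it serves the pentagonal series, with p = s^2 the doubling formula for phi.\<close>

lemma theta_even_odd:
  assumes "norm p < 1" "p \<noteq> 0" "z \<noteq> 0"
  shows "theta p z = theta (p ^ 4) (- (p * z\<^sup>2)) - z * theta (p ^ 4) (- (p ^ 3 * z\<^sup>2))"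
proof -
  have s: "theta_term p z summable_on S" for S
    using summable_on_subset_banach[OF abs_summable_summable[OF theta_summable[of p z]]] assms by blast
  have e: "theta_term p z (2 * j) = theta_term (p ^ 4) (- (p * z\<^sup>2)) j" for j
  proof -
    have "tri (2 * j) = 4 * tri j + j"
      by (rule tri_eqI) (use two_tri[of j] in \<open>simp add: algebra_simps\<close>)
    then show ?thesis
      using assms by (simp add: theta_term_def power_int_add power_int_mult power_int_mult_distrib)
  qed
  have o: "theta_term p z (2 * j + 1) = - z * theta_term (p ^ 4) (- (p ^ 3 * z\<^sup>2)) j" for j
  proof -
    have "tri (2 * j + 1) = 4 * tri j + 3 * j"
      by (rule tri_eqI) (use two_tri[of j] in \<open>simp add: algebra_simps\<close>)
    then show ?thesis
      using assms by (simp add: theta_term_def power_int_add power_int_mult power_int_mult_distrib)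
  qed
  have "theta p z = infsum (theta_term p z) ({k. even k} \<union> {k. odd k})"
    unfolding theta_def by (rule arg_cong[where f = "infsum _"]) auto
  also have "\<dots> = infsum (theta_term p z) {k. even k} + infsum (theta_term p z) {k. odd k}"
    by (rule infsum_Un_disjoint) (auto simp: s)
  also have "infsum (theta_term p z) {k. even k} = (\<Sum>\<^sub>\<infinity>j. theta_term (p ^ 4) (- (p * z\<^sup>2)) j)"
    by (rule infsum_reindex_bij_witness[of _ "\<lambda>j. 2 * j" "\<lambda>k. k div 2"]) (auto simp: e elim!: evenE)
  also have "infsum (theta_term p z) {k. odd k} = (\<Sum>\<^sub>\<infinity>j. - z * theta_term (p ^ 4) (- (p ^ 3 * z\<^sup>2)) j)"
    by (rule infsum_reindex_bij_witness[of _ "\<lambda>j. 2 * j + 1" "\<lambda>k. k div 2"]) (auto simp: o elim!: oddE)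
  finally show ?thesis
    by (simp only: infsum_cmult_right' theta_def) simp
qed

lemma theta_phi_eq_theta:
  assumes "q \<noteq> 0"
  shows "theta_phi q = theta (q\<^sup>2) (- q)"
proof -
  have "q powi (n\<^sup>2) = theta_term (q\<^sup>2) (- q) n" for n
  proof -
    have "n\<^sup>2 = 2 * tri n + n" using two_tri[of n] by (simp add: power2_eq_square algebra_simps)
    then show ?thesis using assms by (simp add: theta_term_def power_int_add power_int_mult)
  qed
  then show ?thesis by (simp add: theta_phi_def theta_def)
qed

lemma theta_phi_double:
  assumes "norm s < 1" "s \<noteq> 0"
  shows "theta_phi s + theta_phi (- s) = 2 * theta_phi (s ^ 4)"
proof -
  have e: "- ((- s)\<^sup>2 * s\<^sup>2) = - (s ^ 4)" "- (s\<^sup>2 * s\<^sup>2) = - (s ^ 4)" "(s\<^sup>2) ^ 4 = (s ^ 4)\<^sup>2"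
    by (simp_all flip: power_add power_mult)
  have "theta_phi s = theta ((s ^ 4)\<^sup>2) (- (s ^ 4)) + s * theta ((s ^ 4)\<^sup>2) (- ((s\<^sup>2) ^ 3 * s\<^sup>2))"
    using theta_even_odd[of "s\<^sup>2" "- s"] assms e norm_power_less_one[of s 2]
    by (simp add: theta_phi_eq_theta)
  moreover have "theta_phi (- s) = theta ((s ^ 4)\<^sup>2) (- (s ^ 4)) - s * theta ((s ^ 4)\<^sup>2) (- ((s\<^sup>2) ^ 3 * s\<^sup>2))"
    using theta_even_odd[of "s\<^sup>2" "s"] assms e norm_power_less_one[of s 2]
    by (simp add: theta_phi_eq_theta)
  moreover have "theta_phi (s ^ 4) = theta ((s ^ 4)\<^sup>2) (- (s ^ 4))"
    using assms by (simp add: theta_phi_eq_theta)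
  ultimately show ?thesis by simp
qed

text \<open>The value at -q is obtained by division: \<open>tprod (q\<^sup>2) q\<close> times
  \<open>tprod (q\<^sup>2) (- q)\<close> is \<open>tprod (q ^ 4) (q\<^sup>2)\<close>, and two of the
  three are instances of \<open>tprod_2\<close>.\<close>

lemma theta_phi_product:
  assumes "norm q < 1" "q \<noteq> 0"
  shows "theta_phi q = euler_E (q\<^sup>2) ^ 5 / (euler_E q ^ 2 * euler_E (q ^ 4) ^ 2)"
proof -
  have q2: "norm (q\<^sup>2) < 1" "norm (q ^ 4) < 1" using assms by (auto intro: norm_power_less_one)
  note nz = euler_E_nonzero[OF assms(1)] euler_E_nonzero[OF q2(1)] euler_E_nonzero[OF q2(2)]
  have "tprod (q\<^sup>2) q * tprod (q\<^sup>2) (- q) * euler_E (q ^ 4) ^ 2 = euler_E (q\<^sup>2) ^ 2"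
    using tprod_2[OF q2(1)] assms by (simp add: tprod_mult_minus[OF q2(1)])
  moreover have "tprod (q\<^sup>2) q = euler_E q ^ 2 / euler_E (q\<^sup>2) ^ 2"
    using tprod_2[OF assms] nz by (simp add: field_simps)
  ultimately have "tprod (q\<^sup>2) (- q) = euler_E (q\<^sup>2) ^ 4 / (euler_E q ^ 2 * euler_E (q ^ 4) ^ 2)"
    using nz by (simp add: field_simps)
  then show ?thesis
    using theta_eq_tprod[OF q2(1), of "- q"] assms nz
    by (simp add: theta_phi_eq_theta eval_nat_numeral)
qed

lemma power_int_neq_minus_one:
  fixes q :: complex
  assumes "norm q < 1"
  shows "q powi m \<noteq> - 1"
proof (cases m rule: int_cases2)
  case (nonneg n)
  then show ?thesis
    using power_neq_minus_one(1)[OF assms, of n] by (cases "n = 0") (auto simp: add_eq_0_iff)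
next
  case (nonpos n)
  show ?thesis
  proof
    assume "q powi m = - 1"
    then have "inverse (q ^ n) = - 1" by (simp add: nonpos power_int_minus)
    then have "q ^ n = - 1" by (metis inverse_inverse_eq inverse_minus_eq inverse_1)
    then show False
      using power_neq_minus_one(1)[OF assms, of n] by (cases "n = 0") auto
  qed
qed

section \<open>Eta quotient evaluations at nomes q^12 and q^24\<close>

context
  fixes q :: complex
  assumes q: "norm q < 1" "q \<noteq> 0"
begin

abbreviation (input) "E n \<equiv> euler_E (q ^ n)"
abbreviation (input) "th \<equiv> theta (q ^ 12)"

lemma norm_q_power_less: "n > 0 \<Longrightarrow> norm (q ^ n) < 1"
  using q by (intro norm_power_less_one)

lemma E_power_nonzero: "n > 0 \<Longrightarrow> E n \<noteq> 0"
  by (intro euler_E_nonzero norm_q_power_less)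

lemmas E_nonzero = E_power_nonzero[of 1, simplified] E_power_nonzero[of 2, simplified] E_power_nonzero[of 3, simplified] E_power_nonzero[of 4, simplified]
  E_power_nonzero[of 6, simplified] E_power_nonzero[of 8, simplified] E_power_nonzero[of 12, simplified] E_power_nonzero[of 24, simplified]

lemma tprod_at_power:
  assumes "k > 0"
  shows "tprod (q ^ (3 * k)) (q ^ k) = E k / E (3 * k)"
    "tprod (q ^ (4 * k)) (q ^ k) = E k / E (2 * k)"
    "tprod (q ^ (6 * k)) (q ^ k) = E k * E (6 * k) / (E (2 * k) * E (3 * k))"
  using tprod_3[OF norm_q_power_less[OF assms]] tprod_4[OF norm_q_power_less[OF assms]] tprod_6[OF norm_q_power_less[OF assms]]
    q assms E_power_nonzero[of "2 * k"] E_power_nonzero[of "3 * k"]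
  by (simp_all add: mult.commute eq_divide_eq flip: power_mult)

text \<open>A value at a negative argument is a quotient of two values at positive arguments, the
  numerator taken with doubled exponents.\<close>

lemma tprod_minus_at_power:
  assumes "tprod (q ^ m) (q ^ k) = c" "tprod (q ^ (2 * m)) (q ^ (2 * k)) = d" "c \<noteq> 0" "m > 0"
  shows "tprod (q ^ m) (- (q ^ k)) = d / c"
  using tprod_mult_minus[OF norm_q_power_less[OF assms(4)], of "q ^ k"] assms
  by (simp add: mult.commute eq_divide_eq flip: power_mult)

lemma euler_E_power:
  "euler_E z ^ 2 = euler_E z * euler_E z" "euler_E z ^ 3 = euler_E z * (euler_E z * euler_E z)"
  "euler_E z ^ 5 = euler_E z * (euler_E z * (euler_E z * (euler_E z * euler_E z)))"
  by (simp_all add: eval_nat_numeral)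

lemma th_tprod: "z \<noteq> 0 \<Longrightarrow> th z = E 12 * tprod (q ^ 12) z"
  using q by (intro theta_eq_tprod norm_q_power_less) auto

lemma th_1_5: "th q * th (q ^ 5) = E 12 ^ 2 * E 1 * E 6 / (E 2 * E 3)"
proof -
  have "tprod (q ^ 12) q * tprod (q ^ 12) (q ^ 5) = tprod (q ^ 6) q"
  proof -
    have "q ^ 6 / q = q ^ 5" using q by (simp add: eval_nat_numeral)
    then show ?thesis
      using tprod_split[OF norm_q_power_less[of 6], of q] q by (simp flip: power_mult)
  qed
  also have "\<dots> = E 1 * E 6 / (E 2 * E 3)"
    using tprod_at_power(3)[of 1] by simp
  finally have "(E 12 * E 12) * (tprod (q ^ 12) q * tprod (q ^ 12) (q ^ 5)) = (E 12 * E 12) * (E 1 * E 6 / (E 2 * E 3))"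
    by simp
  then show ?thesis
    using q by (simp add: th_tprod power2_eq_square mult_ac)
qed

lemma th_1_5_minus:
  "th (- q) * th (- (q ^ 5)) = E 12 ^ 3 * E 2 ^ 2 * E 3 / (E 1 * E 4 * E 6 ^ 2)"
proof -
  have "q ^ 6 / (- q) = - (q ^ 5)" using q by (simp add: eval_nat_numeral)
  then have "tprod (q ^ 12) (- q) * tprod (q ^ 12) (- (q ^ 5)) = tprod (q ^ 6) (- q)"
    using tprod_split[OF norm_q_power_less[of 6], of "- q"] q by (simp flip: power_mult)
  also have "\<dots> = E 12 * E 2 ^ 2 * E 3 / (E 1 * E 4 * E 6 ^ 2)"
  proof -
    have "tprod (q ^ 6) (- q) = E 2 * E 12 / (E 4 * E 6) / (E 1 * E 6 / (E 2 * E 3))"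
      by (rule tprod_minus_at_power[of 6 1, unfolded power_one_right])
        (use tprod_at_power(3)[of 1] tprod_at_power(3)[of 2] E_nonzero in simp_all)
    then show ?thesis using E_nonzero by (simp add: field_simps euler_E_power)
  qed
  finally have "(E 12 * E 12) * (tprod (q ^ 12) (- q) * tprod (q ^ 12) (- (q ^ 5))) =
     (E 12 * E 12) * (E 12 * E 2 ^ 2 * E 3 / (E 1 * E 4 * E 6 ^ 2))"
    by simp
  then show ?thesis
    using q by (simp add: th_tprod power3_eq_cube mult_ac)
qed

lemma th_2: "th (q\<^sup>2) = E 12 ^ 2 * E 2 / (E 4 * E 6)"
  using tprod_at_power(3)[of 2] q by (simp add: th_tprod power2_eq_square)

lemma th_3: "th (q ^ 3) = E 12 * E 3 / E 6"
  using tprod_at_power(2)[of 3] q by (simp add: th_tprod)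

lemma th_4: "th (q ^ 4) = E 4"
  using tprod_at_power(1)[of 4] q E_nonzero by (simp add: th_tprod)

lemma th_2_minus: "th (- (q\<^sup>2)) = E 4 ^ 2 * E 6 * E 24 / (E 2 * E 8 * E 12)"
proof -
  have "tprod (q ^ 12) (- (q\<^sup>2)) = E 4 * E 24 / (E 8 * E 12) / (E 2 * E 12 / (E 4 * E 6))"
    by (rule tprod_minus_at_power)
        (use tprod_at_power(3)[of 2] tprod_at_power(3)[of 4] E_nonzero in simp_all)
  then show ?thesis using q E_nonzero by (simp add: th_tprod field_simps euler_E_power)
qed

lemma th_3_minus: "th (- (q ^ 3)) = E 6 ^ 2 / E 3"
proof -
  have "tprod (q ^ 12) (- (q ^ 3)) = E 6 / E 12 / (E 3 / E 6)"
    by (rule tprod_minus_at_power)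
        (use tprod_at_power(2)[of 3] tprod_at_power(2)[of 6] E_nonzero in simp_all)
  then show ?thesis using q E_nonzero by (simp add: th_tprod field_simps euler_E_power)
qed

lemma th_4_minus: "th (- (q ^ 4)) = E 8 * E 12 ^ 2 / (E 4 * E 24)"
proof -
  have "tprod (q ^ 12) (- (q ^ 4)) = E 8 / E 24 / (E 4 / E 12)"
    by (rule tprod_minus_at_power)
        (use tprod_at_power(1)[of 4] tprod_at_power(1)[of 8] E_nonzero in simp_all)
  then show ?thesis using q E_nonzero by (simp add: th_tprod field_simps euler_E_power)
qed

lemma th_minus_one: "th (- 1) = 2 * E 24 ^ 2 / E 12"
proof -
  have "tprod (q ^ 12) (- 1) * E 12 ^ 2 = 2 * E 24 ^ 2"
    using tprod_minus_one[OF norm_q_power_less[of 12]] by (simp flip: power_mult)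
  then have "tprod (q ^ 12) (- 1) = 2 * E 24 ^ 2 / E 12 ^ 2"
    using E_nonzero by (simp add: eq_divide_eq)
  then show ?thesis using E_nonzero by (simp add: th_tprod euler_E_power)
qed

text \<open>\<open>theta (q ^ 3) q\<close> is Euler's pentagonal series, and its product
  (q^3;q^3)(q;q^3)(q^2;q^3) is E(q). Separation by parity raises the nome q^3 to q^12; the argument
  -q^11 that arises is reflected to -q.\<close>

lemma th_pentagonal: "th (- (q ^ 5)) - q * th (- q) = E 1"
proof -
  have e: "- (q ^ 3 * q\<^sup>2) = - (q ^ 5)" "(q ^ 3) ^ 4 = q ^ 12" "- ((q ^ 3) ^ 3 * q\<^sup>2) = q ^ 12 / (- q)"
    using q by (simp_all add: eval_nat_numeral)
  have "theta (q ^ 3) q = th (- (q ^ 5)) - q * th (q ^ 12 / (- q))"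
    using theta_even_odd[OF norm_q_power_less[of 3], of q] q unfolding e by simp
  also have "th (q ^ 12 / (- q)) = th (- q)"
    by (rule theta_nome_divide) (use q in auto)
  also have "theta (q ^ 3) q = E 3 * tprod (q ^ 3) q"
    using q by (intro theta_eq_tprod norm_q_power_less) auto
  also have "\<dots> = E 1" using tprod_at_power(1)[of 1] E_nonzero by simp
  finally show ?thesis by simp
qed

lemma th_pentagonal_minus: "th (- (q ^ 5)) + q * th (- q) = E 2 * E 3 ^ 2 / (E 1 * E 6)"
proof -
  have e: "- (q ^ 3 * (- q)\<^sup>2) = - (q ^ 5)" "(q ^ 3) ^ 4 = q ^ 12" "- ((q ^ 3) ^ 3 * (- q)\<^sup>2) = q ^ 12 / (- q)"
    using q by (simp_all add: eval_nat_numeral)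
  have "theta (q ^ 3) (- q) = th (- (q ^ 5)) + q * th (q ^ 12 / (- q))"
    using theta_even_odd[OF norm_q_power_less[of 3], of "- q"] q unfolding e by simp
  also have "th (q ^ 12 / (- q)) = th (- q)"
    by (rule theta_nome_divide) (use q in auto)
  also have "theta (q ^ 3) (- q) = E 3 * tprod (q ^ 3) (- q)"
    using q by (intro theta_eq_tprod norm_q_power_less) auto
  also have "\<dots> = E 2 * E 3 ^ 2 / (E 1 * E 6)"
  proof -
    have "tprod (q ^ 3) (- q) = E 2 / E 6 / (E 1 / E 3)"
      by (rule tprod_minus_at_power[of 3 1, unfolded power_one_right])
        (use tprod_at_power(1)[of 1] tprod_at_power(1)[of 2] E_nonzero in simp_all)
    then show ?thesis using E_nonzero by (simp add: field_simps euler_E_power)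
  qed
  finally show ?thesis by simp
qed

lemma theta_24: "theta (q ^ 24) (q ^ 6) = E 24 * E 6 / E 12" "theta (q ^ 24) (q ^ 8) = E 8"
  "theta (q ^ 24) (q ^ 4) = E 24 ^ 2 * E 4 / (E 8 * E 12)"
proof -
  have t: "theta (q ^ 24) (q ^ k) = E 24 * tprod (q ^ 24) (q ^ k)" for k
    using q by (intro theta_eq_tprod norm_q_power_less) auto
  show "theta (q ^ 24) (q ^ 6) = E 24 * E 6 / E 12" "theta (q ^ 24) (q ^ 8) = E 8"
    "theta (q ^ 24) (q ^ 4) = E 24 ^ 2 * E 4 / (E 8 * E 12)"
    unfolding t using tprod_at_power(2)[of 6] tprod_at_power(1)[of 8] tprod_at_power(3)[of 4] E_nonzero
    by (simp_all add: power2_eq_square)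
qed

lemma th_sum: "th (- q) * th (q ^ 5) + th q * th (- (q ^ 5)) = 2 * E 24 * E 6 * E 8 / E 12"
proof -
  have "q ^ 12 * q / q ^ 5 = q ^ 8" "q * q ^ 5 = q ^ 6" using q by (simp_all add: eval_nat_numeral)
  then show ?thesis
    using theta_mult_sum[of "q ^ 12" q "q ^ 5"] norm_q_power_less[of 12] q theta_24 by (simp flip: power_mult)
qed

lemma th_diff: "th (- q) * th (q ^ 5) - th q * th (- (q ^ 5)) = 2 * q * E 24 ^ 3 * E 6 * E 4 / (E 8 * E 12 ^ 2)"
proof -
  \<comment> \<open>The addition formula produces the arguments q^18 and q^20, which are reflected
    at nome q^24 to q^6 and q^4.\<close>
  have e: "q ^ 24 * q / q ^ 5 = q ^ 24 / q ^ 4" "q ^ 12 * q * q ^ 5 = q ^ 24 / q ^ 6"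
    using q by (simp_all add: eval_nat_numeral)
  have n: "theta (q ^ 24) (q ^ 24 / q ^ k) = theta (q ^ 24) (q ^ k)" for k
    by (rule theta_nome_divide) (use q in auto)
  have "th (- q) * th (q ^ 5) - th q * th (- (q ^ 5)) =
     2 * q * theta (q ^ 24) (q ^ 12 * q * q ^ 5) * theta (q ^ 24) (q ^ 24 * q / q ^ 5)"
    using theta_mult_diff[of "q ^ 12" q "q ^ 5"] norm_q_power_less[of 12] q by (simp flip: power_mult)
  then show ?thesis
    unfolding e n theta_24 using E_nonzero by (simp add: field_simps eval_nat_numeral)
qed

text \<open>
  The three-term relation at x = q^15, y = -q^5, u = q^(-10), v = q^(-5). For these values the
  first and the third product have the factors at -q^2 and q^5 in common, up to the
  quasi-periodicity of theta, and what remains is the numerator of A - D.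
\<close>

lemma th_quartic:
  "th (- (q ^ 4)) * th (- (q\<^sup>2)) * th (q ^ 3) * th (q ^ 5) - q\<^sup>2 * th (- 1) * th (- (q\<^sup>2)) * th (q ^ 5) * th q =
   th (q\<^sup>2) * th (q ^ 4) * th (- (q ^ 5)) * th (- (q ^ 3))"
proof -
  have p: "q ^ 12 \<noteq> 0" using q by simp
  have div: "th w = th z" if "q ^ 12 = w * z" "z \<noteq> 0" for w z
    using theta_nome_divide[OF p that(2)] that by simp
  have mul: "th w = - th z / z" if "w = q ^ 12 * z" "z \<noteq> 0" for w z
    using theta_mult_nome[OF p that(2)] that by simp
  have inv: "th w = - th z / z" if "w * z = 1" "z \<noteq> 0" for w z
  proof -
    have "w = 1 / z" using that by (simp add: eq_divide_eq)
    then show ?thesis using theta_inverse[OF p that(2)] by simp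
  qed
  have d: "th (q ^ 10) = th (q\<^sup>2)" "th (- (q ^ 10)) = th (- (q\<^sup>2))"
    "th (q ^ 8) = th (q ^ 4)" "th (- (q ^ 8)) = th (- (q ^ 4))"
    by (rule div; use q in \<open>simp flip: power_add\<close>)+
  have m: "th (q ^ 20) = - th (q ^ 8) / q ^ 8" "th (- (q ^ 20)) = - th (- (q ^ 8)) / - (q ^ 8)"
    "th (q ^ 25) = - th (q ^ 13) / q ^ 13" "th (q ^ 15) = - th (q ^ 3) / q ^ 3"
    "th (- (q ^ 15)) = - th (- (q ^ 3)) / - (q ^ 3)"
    by (rule mul; use q in \<open>simp flip: power_add\<close>)+
  have m': "th (q ^ 13) = - th q / q"
    by (rule mul) (use q in \<open>simp_all flip: power_Suc2\<close>)
  have i: "th (1 / q ^ 5) = - th (q ^ 5) / q ^ 5" "th (- 1 / q ^ 5) = - th (- (q ^ 5)) / - (q ^ 5)"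
    "th (1 / q ^ 15) = - th (q ^ 15) / q ^ 15" "th (- 1 / q ^ 15) = - th (- (q ^ 15)) / - (q ^ 15)"
    by (rule inv; use q in simp)+
  have r: "th (q ^ 20) = - th (q ^ 4) / q ^ 8" "th (- (q ^ 20)) = th (- (q ^ 4)) / q ^ 8"
     "th (q ^ 25) = th q / q ^ 14" "th (1 / q ^ 5) = - th (q ^ 5) / q ^ 5" "th (- 1 / q ^ 5) = th (- (q ^ 5)) / q ^ 5"
     "th (1 / q ^ 15) = th (q ^ 3) / q ^ 18" "th (- 1 / q ^ 15) = th (- (q ^ 3)) / q ^ 18"
    unfolding i m m' d by (simp_all flip: power_add power_Suc)
  have "th (q ^ 15 * - (q ^ 5)) * th (q ^ 15 / - (q ^ 5)) * (th (1 / q ^ 10 * (1 / q ^ 5)) * th (1 / q ^ 10 / (1 / q ^ 5))) -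
     th (q ^ 15 * (1 / q ^ 5)) * th (q ^ 15 / (1 / q ^ 5)) * (th (1 / q ^ 10 * - (q ^ 5)) * th (1 / q ^ 10 / - (q ^ 5))) =
     1 / q ^ 10 / - (q ^ 5) * (th (- (q ^ 5) * (1 / q ^ 5)) * th (- (q ^ 5) / (1 / q ^ 5)) *
       (th (q ^ 15 * (1 / q ^ 10)) * th (q ^ 15 / (1 / q ^ 10))))"
    using q norm_q_power_less[of 12] by (intro theta_three_term) auto
  moreover have "q ^ 15 * - (q ^ 5) = - (q ^ 20)" "q ^ 15 / - (q ^ 5) = - (q ^ 10)"
    "1 / q ^ 10 * (1 / q ^ 5) = 1 / q ^ 15" "1 / q ^ 10 / (1 / q ^ 5) = 1 / q ^ 5"
    "q ^ 15 * (1 / q ^ 5) = q ^ 10" "q ^ 15 / (1 / q ^ 5) = q ^ 20"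
    "1 / q ^ 10 * - (q ^ 5) = - 1 / q ^ 5" "1 / q ^ 10 / - (q ^ 5) = - 1 / q ^ 15"
    "- (q ^ 5) * (1 / q ^ 5) = - 1" "- (q ^ 5) / (1 / q ^ 5) = - (q ^ 10)"
    "q ^ 15 * (1 / q ^ 10) = q ^ 5" "q ^ 15 / (1 / q ^ 10) = q ^ 25"
    using q by (simp_all add: eval_nat_numeral)
  ultimately have "th (- (q ^ 4)) / q ^ 8 * th (- (q\<^sup>2)) * (th (q ^ 3) / q ^ 18 * (- th (q ^ 5) / q ^ 5)) -
     th (q\<^sup>2) * (- th (q ^ 4) / q ^ 8) * (th (- (q ^ 5)) / q ^ 5 * (th (- (q ^ 3)) / q ^ 18)) =
     - 1 / q ^ 15 * (th (- 1) * th (- (q\<^sup>2)) * (th (q ^ 5) * (th q / q ^ 14)))"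
    by (simp only: r d)
  \<comment> \<open>In all three products the powers of q from the quasi-periodicity are collected:
    8 + 18 + 5 = 31 twice, and 15 + 14 = 29 once. The difference of 2 is the origin of the factor
    q^2.\<close>
  moreover have "th (- (q ^ 4)) / q ^ 8 * th (- (q\<^sup>2)) * (th (q ^ 3) / q ^ 18 * (- th (q ^ 5) / q ^ 5)) =
      - (th (- (q ^ 4)) * th (- (q\<^sup>2)) * th (q ^ 3) * th (q ^ 5)) / q ^ 31"
    by (simp add: mult_ac flip: power_add)
  moreover have "th (q\<^sup>2) * (- th (q ^ 4) / q ^ 8) * (th (- (q ^ 5)) / q ^ 5 * (th (- (q ^ 3)) / q ^ 18)) =
      - (th (q\<^sup>2) * th (q ^ 4) * th (- (q ^ 5)) * th (- (q ^ 3))) / q ^ 31"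
    by (simp add: mult_ac flip: power_add)
  moreover have "- 1 / q ^ 15 * (th (- 1) * th (- (q\<^sup>2)) * (th (q ^ 5) * (th q / q ^ 14))) =
      - (q\<^sup>2 * th (- 1) * th (- (q\<^sup>2)) * th (q ^ 5) * th q) / q ^ 31"
  proof -
    have e: "q ^ 31 = q ^ 29 * q\<^sup>2" by (simp flip: power_add)
    have "q\<^sup>2 * c / q ^ 31 = c / q ^ 29" for c
      unfolding e mult.commute[of "q\<^sup>2" c] using q by (intro mult_divide_mult_cancel_right) simp
    from this[of "th (- 1) * th (- (q\<^sup>2)) * th (q ^ 5) * th q"]
    show ?thesis by (simp add: mult.assoc flip: power_add)
  qed
  ultimately show ?thesis
    using q by (simp add: diff_divide_distrib[symmetric] del: divide_minus_left minus_divide_left mult_minus_left)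
      (simp add: algebra_simps)
qed

text \<open>Kronecker's identity at p = q^12, a = -q^j, x = q^i. The bounds on \<open>i\<close>
  express that x lies in the annulus, and no denominator vanishes because no integral power of q is
  -1.\<close>

lemma lattice_sum:
  assumes "0 < i" "i < 12"
  shows "(\<lambda>n::int. q powi (int i * n) / (1 + q powi (12 * n + int j))) summable_on UNIV"
    and "th (- (q ^ j)) * th (q ^ i) * (\<Sum>\<^sub>\<infinity>n::int. q powi (int i * n) / (1 + q powi (12 * n + int j))) =
      E 12 ^ 3 * th (- (q ^ (i + j)))"
proof -
  have e: "kron_term (q ^ 12) (- (q ^ j)) (q ^ i) n = q powi (int i * n) / (1 + q powi (12 * n + int j))" for n
    using q by (simp add: kron_term_def power_int_power power_int_add mult.commute)
  have a: "- (q ^ j) * (q ^ 12) powi n \<noteq> 1" for n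
  proof -
    have "q ^ j * (q ^ 12) powi n = q powi (12 * n + int j)"
      using q by (simp add: power_int_power power_int_add)
    then show ?thesis using power_int_neq_minus_one[OF q(1), of "12 * n + int j"]
      by (metis minus_equation_iff mult_minus_left)
  qed
  have x: "norm (q ^ 12) < norm (q ^ i)" "norm (q ^ i) < 1"
    using assms q norm_q_power_less[of i] by (auto simp: norm_power intro!: power_strict_decreasing)
  have p: "q ^ 12 \<noteq> 0" "norm (q ^ 12) < 1" "- (q ^ j) \<noteq> 0" using q norm_q_power_less[of 12] by auto
  show "(\<lambda>n::int. q powi (int i * n) / (1 + q powi (12 * n + int j))) summable_on UNIV"
    using abs_summable_summable[OF kron_summable[OF p a x]] unfolding e .
  show "th (- (q ^ j)) * th (q ^ i) * (\<Sum>\<^sub>\<infinity>n::int. q powi (int i * n) / (1 + q powi (12 * n + int j))) =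
      E 12 ^ 3 * th (- (q ^ (i + j)))"
    using kronecker_theta_identity[OF p a x] unfolding e by (simp add: power_add mult.commute)
qed

lemma th_nonzero:
  "th q \<noteq> 0" "th (q ^ 5) \<noteq> 0" "th (q ^ 3) \<noteq> 0" "th (- 1) \<noteq> 0" "th (- (q\<^sup>2)) \<noteq> 0" "th (- (q ^ 4)) \<noteq> 0"
proof -
  have "th q * th (q ^ 5) \<noteq> 0" unfolding th_1_5 using E_nonzero by simp
  then show "th q \<noteq> 0" "th (q ^ 5) \<noteq> 0" by auto
  show "th (q ^ 3) \<noteq> 0" "th (- 1) \<noteq> 0" "th (- (q\<^sup>2)) \<noteq> 0" "th (- (q ^ 4)) \<noteq> 0"
    unfolding th_3 th_minus_one th_2_minus th_4_minus using E_nonzero by simp_all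
qed

section \<open>The four bilateral sums as theta quotients and their linear relations\<close>

definition "sum_A = (\<Sum>\<^sub>\<infinity>n::int. q powi n / (1 + q powi (12 * n)))"
definition "sum_B = (\<Sum>\<^sub>\<infinity>n::int. q powi (5 * n) / (1 + q powi (12 * n)))"
definition "sum_C = (\<Sum>\<^sub>\<infinity>n::int. q powi (3 * n + 1) / (1 + q powi (12 * n + 4)))"
definition "sum_D = (\<Sum>\<^sub>\<infinity>n::int. q powi (9 * n + 3) / (1 + q powi (12 * n + 4)))"

lemma shifted_term:
  "q powi (3 * n + 1) / (1 + q powi (12 * n + 4)) = q * (q powi (int 3 * n) / (1 + q powi (12 * n + int 4)))"
  "q powi (9 * n + 3) / (1 + q powi (12 * n + 4)) = q ^ 3 * (q powi (int 9 * n) / (1 + q powi (12 * n + int 4)))"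
  using q by (simp_all add: power_int_add)

lemma lattice_sums_summable:
  "(\<lambda>n::int. q powi n / (1 + q powi (12 * n))) summable_on UNIV"
  "(\<lambda>n::int. q powi (5 * n) / (1 + q powi (12 * n))) summable_on UNIV"
  "(\<lambda>n::int. q powi (3 * n + 1) / (1 + q powi (12 * n + 4))) summable_on UNIV"
  "(\<lambda>n::int. q powi (9 * n + 3) / (1 + q powi (12 * n + 4))) summable_on UNIV"
proof -
  show "(\<lambda>n::int. q powi n / (1 + q powi (12 * n))) summable_on UNIV"
    using lattice_sum(1)[of 1 0] by simp
  show "(\<lambda>n::int. q powi (5 * n) / (1 + q powi (12 * n))) summable_on UNIV"
    using lattice_sum(1)[of 5 0] by simp
  show "(\<lambda>n::int. q powi (3 * n + 1) / (1 + q powi (12 * n + 4))) summable_on UNIV"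
    unfolding shifted_term by (intro summable_on_cmult_right lattice_sum) auto
  show "(\<lambda>n::int. q powi (9 * n + 3) / (1 + q powi (12 * n + 4))) summable_on UNIV"
    unfolding shifted_term by (intro summable_on_cmult_right lattice_sum) auto
qed

text \<open>The instances (i, j) = (1, 0), (5, 0), (3, 4), (9, 4). The numerators at -q^7 and -q^13
  and the denominator at q^9 are brought back to -q^5, -q and q^3; the quasi-period of the second
  costs 1/q, which lowers q^3 to q^2 in \<open>sum_D\<close>.\<close>

lemma lattice_sums:
  "sum_A = E 12 ^ 3 * th (- q) / (th (- 1) * th q)"
  "sum_B = E 12 ^ 3 * th (- (q ^ 5)) / (th (- 1) * th (q ^ 5))"
  "sum_C = q * (E 12 ^ 3 * th (- (q ^ 5)) / (th (- (q ^ 4)) * th (q ^ 3)))"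
  "sum_D = q\<^sup>2 * (E 12 ^ 3 * th (- q) / (th (- (q ^ 4)) * th (q ^ 3)))"
proof -
  have p: "q ^ 12 \<noteq> 0" using q by simp
  have div: "th w = th z" if "q ^ 12 = w * z" "z \<noteq> 0" for w z
    using theta_nome_divide[OF p that(2)] that by simp
  have d: "th (- (q ^ 7)) = th (- (q ^ 5))" "th (q ^ 9) = th (q ^ 3)"
    by (rule div; use q in \<open>simp flip: power_add\<close>)+
  have "q ^ 12 * - q = - (q ^ 13)" by (simp flip: power_Suc2)
  then have m: "th (- (q ^ 13)) = th (- q) / q"
    using theta_mult_nome[OF p, of "- q"] q by simp
  show "sum_A = E 12 ^ 3 * th (- q) / (th (- 1) * th q)"
    using lattice_sum(2)[of 1 0] th_nonzero by (simp add: sum_A_def eq_divide_eq mult.commute)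
  show "sum_B = E 12 ^ 3 * th (- (q ^ 5)) / (th (- 1) * th (q ^ 5))"
    using lattice_sum(2)[of 5 0] th_nonzero by (simp add: sum_B_def eq_divide_eq mult.commute)
  show "sum_C = q * (E 12 ^ 3 * th (- (q ^ 5)) / (th (- (q ^ 4)) * th (q ^ 3)))"
    using lattice_sum(2)[of 3 4] th_nonzero d
    unfolding sum_C_def shifted_term infsum_cmult_right' by (simp add: eq_divide_eq mult.commute)
  have L: "th (- (q ^ 4)) * th (q ^ 3) * (\<Sum>\<^sub>\<infinity>n. q powi (int 9 * n) / (1 + q powi (12 * n + int 4))) =
      E 12 ^ 3 * (th (- q) / q)"
    using lattice_sum(2)[of 9 4] d m by simp
  have "(\<Sum>\<^sub>\<infinity>n. q powi (int 9 * n) / (1 + q powi (12 * n + int 4))) =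
      E 12 ^ 3 * (th (- q) / q) / (th (- (q ^ 4)) * th (q ^ 3))"
    unfolding L[symmetric] using th_nonzero by simp
  then show "sum_D = q\<^sup>2 * (E 12 ^ 3 * th (- q) / (th (- (q ^ 4)) * th (q ^ 3)))"
    unfolding sum_D_def shifted_term infsum_cmult_right'
    using q by (simp add: power3_eq_cube power2_eq_square)
qed

text \<open>Over the common denominator the values at q and q^5 occur only through their product,
  and the numerator is the one of \<open>th_sum\<close>.\<close>

lemma sum_A_plus_B: "sum_A + sum_B = P_quot q"
proof -
  have "sum_A + sum_B = E 12 ^ 3 * (th (- q) * th (q ^ 5) + th q * th (- (q ^ 5))) / (th (- 1) * (th q * th (q ^ 5)))"
    unfolding lattice_sums using th_nonzero by (simp add: add_divide_distrib distrib_left mult_ac)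
  also have "\<dots> = P_quot q"
    unfolding th_sum th_1_5 th_minus_one P_quot_def using E_nonzero
    by (simp add: euler_E_power mult_ac)
  finally show ?thesis .
qed

lemma sum_C_minus_D: "sum_C - sum_D = Q_quot q"
proof -
  have "sum_C - sum_D = q * E 12 ^ 3 * (th (- (q ^ 5)) - q * th (- q)) / (th (- (q ^ 4)) * th (q ^ 3))"
    unfolding lattice_sums by (simp add: diff_divide_distrib right_diff_distrib power2_eq_square mult_ac)
  also have "\<dots> = Q_quot q"
    unfolding th_pentagonal th_4_minus th_3 Q_quot_def using E_nonzero
    by (simp add: euler_E_power mult_ac)
  finally show ?thesis .
qed

lemma sum_A_minus_B: "sum_A - sum_B = sum_C + sum_D"
proof -
  have "sum_A - sum_B = E 12 ^ 3 * (th (- q) * th (q ^ 5) - th q * th (- (q ^ 5))) / (th (- 1) * (th q * th (q ^ 5)))"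
    unfolding lattice_sums using th_nonzero by (simp add: diff_divide_distrib right_diff_distrib mult_ac)
  also have "\<dots> = q * (E 24 * E 4 * E 2 * E 3) / (E 8 * E 1)"
    unfolding th_diff th_1_5 th_minus_one using E_nonzero
    by (simp add: euler_E_power mult_ac)
  also have "\<dots> = q * E 12 ^ 3 * (th (- (q ^ 5)) + q * th (- q)) / (th (- (q ^ 4)) * th (q ^ 3))"
    unfolding th_pentagonal_minus th_4_minus th_3 using E_nonzero
    by (simp add: euler_E_power mult_ac)
  also have "\<dots> = sum_C + sum_D"
    unfolding lattice_sums by (simp add: add_divide_distrib distrib_left power2_eq_square mult_ac)
  finally show ?thesis .
qed

text \<open>Over the common denominator, \<open>th_quartic\<close> replaces the difference in the
  numerator by a single product. Its factor at -q^5 joins the one at -q, so that every value left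
  has an eta quotient evaluation; the result is the product formula of phi at q and at q^6.\<close>

lemma sum_A_minus_D: "2 * (sum_A - sum_D) = theta_phi q * theta_phi (q ^ 6)"
proof -
  have "th (- (q ^ 4)) * th (q ^ 3) - q\<^sup>2 * th (- 1) * th q =
      th (q\<^sup>2) * th (q ^ 4) * th (- (q ^ 5)) * th (- (q ^ 3)) / (th (- (q\<^sup>2)) * th (q ^ 5))"
    using th_quartic th_nonzero by (simp add: eq_divide_eq) (simp add: algebra_simps)
  moreover have "2 * (sum_A - sum_D) = 2 * E 12 ^ 3 * th (- q) *
      (th (- (q ^ 4)) * th (q ^ 3) - q\<^sup>2 * th (- 1) * th q) / (th (- 1) * th q * th (- (q ^ 4)) * th (q ^ 3))"
    unfolding lattice_sums using th_nonzero by (simp add: diff_divide_distrib right_diff_distrib mult_ac)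
  ultimately have "2 * (sum_A - sum_D) = 2 * E 12 ^ 3 * (th (- q) * th (- (q ^ 5))) * th (q\<^sup>2) * th (q ^ 4) * th (- (q ^ 3)) /
      (th (- 1) * (th q * th (q ^ 5)) * th (- (q ^ 4)) * th (q ^ 3) * th (- (q\<^sup>2)))"
    by (simp add: mult_ac)
  also have "\<dots> = E 2 ^ 5 * E 12 ^ 5 / (E 1 ^ 2 * E 4 ^ 2 * E 6 ^ 2 * E 24 ^ 2)"
    unfolding th_1_5 th_1_5_minus th_2 th_3 th_4 th_2_minus th_3_minus th_4_minus th_minus_one
    using E_nonzero by (simp add: euler_E_power mult_ac)
  also have "\<dots> = theta_phi q * theta_phi (q ^ 6)"
    using theta_phi_product[OF q] theta_phi_product[of "q ^ 6"] norm_q_power_less[of 6] q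
    by (simp flip: power_mult)
  finally show ?thesis .
qed

end

section \<open>The case q = 0 and the final assembly\<close>

lemma has_sum_diff:
  fixes f g :: "'a \<Rightarrow> 'b :: topological_ab_group_add"
  assumes "(f has_sum a) A" "(g has_sum b) A"
  shows "((\<lambda>x. f x - g x) has_sum (a - b)) A"
  using has_sum_add[OF assms(1), of "\<lambda>x. - g x" "- b"] assms(2) by (simp add: has_sum_uminus)

lemma infsum_single_nonzero:
  fixes f :: "int \<Rightarrow> complex"
  assumes "\<And>n. n \<noteq> 0 \<Longrightarrow> f n = 0"
  shows "f summable_on UNIV \<and> infsum f UNIV = f 0"
proof -
  have "(f has_sum f 0) UNIV \<longleftrightarrow> (f has_sum f 0) {0}"
    by (rule has_sum_cong_neutral) (use assms in auto)
  then have "(f has_sum f 0) UNIV" by (auto simp: has_sum_finiteI)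
  then show ?thesis by (simp add: has_sum_iff)
qed

text \<open>At q = 0 a term survives only through an exponent 0, and these exponents never vanish;
  so the shifted series are 0 there.\<close>

lemma three_n_plus_one_nonzero: "3 * n + 1 \<noteq> (0 :: int)" "9 * n + 3 \<noteq> (0 :: int)" "12 * n + 4 \<noteq> (0 :: int)"
  by presburger+

lemma euler_E_0: "euler_E 0 = 1"
  by (simp add: euler_E_def)

lemma theta_phi_0: "theta_phi 0 = 1"
  using infsum_single_nonzero[of "\<lambda>n. 0 powi (n\<^sup>2)"] by (simp add: theta_phi_def)

lemma P_quot_lambert:
  fixes q :: complex
  assumes "norm q < 1" "q \<noteq> 0"
  shows "((\<lambda>n::int. (q powi n + q powi (5 * n)) / (1 + q powi (12 * n))) has_sum P_quot q) UNIV"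
    and "P_quot q = 1 + (\<Sum>\<^sub>\<infinity>n\<in>{1::nat..}. of_int (chi (int n)) * (q ^ n / (1 - q ^ n)))"
proof -
  have s: "((\<lambda>n::int. q powi n / (1 + q powi (12 * n)) + q powi (5 * n) / (1 + q powi (12 * n)))
      has_sum (sum_A q + sum_B q)) UNIV"
    using lattice_sums_summable[OF assms] unfolding sum_A_def[OF assms] sum_B_def[OF assms]
    by (intro has_sum_add) simp_all
  then show 1: "((\<lambda>n::int. (q powi n + q powi (5 * n)) / (1 + q powi (12 * n))) has_sum P_quot q) UNIV"
    unfolding sum_A_plus_B[OF assms] by (simp add: add_divide_distrib)
  show "P_quot q = 1 + (\<Sum>\<^sub>\<infinity>n\<in>{1::nat..}. of_int (chi (int n)) * (q ^ n / (1 - q ^ n)))"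
    using bilateral_P_lambert[OF assms has_sum_imp_summable[OF 1]] infsumI[OF 1] by simp
qed

lemma Q_quot_lambert:
  fixes q :: complex
  assumes "norm q < 1" "q \<noteq> 0"
  shows "((\<lambda>n::int. (q powi (3 * n + 1) - q powi (9 * n + 3)) / (1 + q powi (12 * n + 4))) has_sum Q_quot q) UNIV"
    and "Q_quot q = (\<Sum>\<^sub>\<infinity>n\<in>{1::nat..}. of_int (Legendre (int n) 3) * lambert_h (q ^ n))"
proof -
  have s: "((\<lambda>n::int. q powi (3 * n + 1) / (1 + q powi (12 * n + 4)) - q powi (9 * n + 3) / (1 + q powi (12 * n + 4)))
      has_sum (sum_C q - sum_D q)) UNIV"
    using lattice_sums_summable[OF assms] unfolding sum_C_def[OF assms] sum_D_def[OF assms]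
    by (intro has_sum_diff) simp_all
  then show 1: "((\<lambda>n::int. (q powi (3 * n + 1) - q powi (9 * n + 3)) / (1 + q powi (12 * n + 4))) has_sum Q_quot q) UNIV"
    unfolding sum_C_minus_D[OF assms] by (simp add: diff_divide_distrib)
  show "Q_quot q = (\<Sum>\<^sub>\<infinity>n\<in>{1::nat..}. of_int (Legendre (int n) 3) * lambert_h (q ^ n))"
    using bilateral_Q_lambert[OF assms] infsumI[OF 1] by simp
qed

lemma phi_1_6:
  fixes q :: complex
  assumes "norm q < 1" "q \<noteq> 0"
  shows "theta_phi q * theta_phi (q ^ 6) = P_quot q + Q_quot q"
proof -
  have "P_quot q + Q_quot q = sum_A q - sum_D q + (sum_B q + sum_C q)"
    by (simp flip: sum_A_plus_B[OF assms] sum_C_minus_D[OF assms])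
  also have "sum_B q + sum_C q = sum_A q - sum_D q"
    using sum_A_minus_B[OF assms] by (simp add: algebra_simps)
  finally show ?thesis using sum_A_minus_D[OF assms] by simp
qed

text \<open>
  Adding the preceding identity at the two square roots of q keeps the even powers only. On the
  Lambert series this multiplies P by 2 and Q by -2, because the character of P vanishes at 2 and
  that of Q is -1 there.
\<close>

lemma phi_2_3:
  fixes q :: complex
  assumes "norm q < 1" "q \<noteq> 0"
  shows "theta_phi (q\<^sup>2) * theta_phi (q ^ 3) = P_quot q - Q_quot q"
proof -
  define s where "s = csqrt q"
  have s: "s\<^sup>2 = q" by (simp add: s_def)
  have "norm s ^ 2 < 1" using assms s by (simp flip: norm_power)
  then have s1: "norm s < 1" by (simp add: power_less_one_iff)
  have s0: "s \<noteq> 0" using assms s by auto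
  have m1: "norm (- s) < 1" "- s \<noteq> 0" using s1 s0 by auto
  have P: "P_quot s + P_quot (- s) = 2 * P_quot q"
    unfolding P_quot_lambert(2)[OF s1 s0] P_quot_lambert(2)[OF m1] P_quot_lambert(2)[OF assms]
    using lambert_chi_double[OF s1] s by (simp add: algebra_simps)
  have Q: "Q_quot s + Q_quot (- s) = - 2 * Q_quot q"
    unfolding Q_quot_lambert(2)[OF s1 s0] Q_quot_lambert(2)[OF m1] Q_quot_lambert(2)[OF assms]
    using lambert_h_double[OF s1] s by simp
  \<comment> \<open>The factor \<open>theta_phi (s ^ 6)\<close> is the same for both square roots,
    so only the factor \<open>theta_phi s\<close> is averaged, and that average is phi at s^4 =
    q^2.\<close>
  have e: "s ^ 4 = q\<^sup>2" "s ^ 6 = q ^ 3" "(- s) ^ 6 = q ^ 3"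
    unfolding s[symmetric] by (simp_all flip: power_mult)
  have "2 * (theta_phi (q\<^sup>2) * theta_phi (q ^ 3)) = (theta_phi s + theta_phi (- s)) * theta_phi (q ^ 3)"
    using theta_phi_double[OF s1 s0] e by simp
  also have "\<dots> = (P_quot s + P_quot (- s)) + (Q_quot s + Q_quot (- s))"
    using phi_1_6[OF s1 s0] phi_1_6[OF m1] e by (simp add: algebra_simps)
  also have "\<dots> = 2 * (P_quot q - Q_quot q)"
    unfolding P Q by simp
  finally show ?thesis by (rule mult_left_cancel[THEN iffD1, rotated]) simp
qed

theorem theorem4p1:
  fixes q :: complex
  assumes "norm q < 1"
  shows
   "(\<lambda>n::int. (q powi n + q powi (5*n)) / (1 + q powi (12*n))) summable_on UNIV \<and>
    (\<lambda>n::int. (q powi (3*n+1) - q powi (9*n+3)) / (1 + q powi (12*n+4))) summable_on UNIV \<and>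
    (\<lambda>n::int. q powi n / (1 + q powi (12*n))) summable_on UNIV \<and>
    (\<lambda>n::int. q powi (5*n) / (1 + q powi (12*n))) summable_on UNIV \<and>
    (\<lambda>n::int. q powi (3*n+1) / (1 + q powi (12*n+4))) summable_on UNIV \<and>
    (\<lambda>n::int. q powi (9*n+3) / (1 + q powi (12*n+4))) summable_on UNIV \<and>
    (\<lambda>n::nat. of_int (kronecker (-6) (int n)) * (q^n / (1 - q^n))) summable_on {1..} \<and>
    (\<lambda>n::nat. of_int (Legendre (int n) 3) * (q^n * (1 - q^(2*n)) / (1 + q^(4*n))))
       summable_on {1..} \<and>
    P_quot q = (\<Sum>\<^sub>\<infinity>n\<in>(UNIV::int set). (q powi n + q powi (5*n)) / (1 + q powi (12*n))) \<and>
    P_quot q =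
       1 + (\<Sum>\<^sub>\<infinity>n\<in>{1::nat..}. of_int (kronecker (-6) (int n)) * (q^n / (1 - q^n))) \<and>
    Q_quot q =
       (\<Sum>\<^sub>\<infinity>n\<in>(UNIV::int set). (q powi (3*n+1) - q powi (9*n+3)) / (1 + q powi (12*n+4))) \<and>
    Q_quot q =
       (\<Sum>\<^sub>\<infinity>n\<in>{1::nat..}.
          of_int (Legendre (int n) 3) * (q^n * (1 - q^(2*n)) / (1 + q^(4*n)))) \<and>
    theta_phi q * theta_phi (q^6) = P_quot q + Q_quot q \<and>
    theta_phi q * theta_phi (q^6) =
       2 * ((\<Sum>\<^sub>\<infinity>n\<in>(UNIV::int set). q powi n / (1 + q powi (12*n)))
          - (\<Sum>\<^sub>\<infinity>n\<in>(UNIV::int set). q powi (9*n+3) / (1 + q powi (12*n+4)))) \<and>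
    theta_phi q * theta_phi (q^6) =
       2 * ((\<Sum>\<^sub>\<infinity>n\<in>(UNIV::int set). q powi (5*n) / (1 + q powi (12*n)))
          + (\<Sum>\<^sub>\<infinity>n\<in>(UNIV::int set). q powi (3*n+1) / (1 + q powi (12*n+4)))) \<and>
    theta_phi (q^2) * theta_phi (q^3) = P_quot q - Q_quot q \<and>
    theta_phi (q^2) * theta_phi (q^3) =
       2 * ((\<Sum>\<^sub>\<infinity>n\<in>(UNIV::int set). q powi n / (1 + q powi (12*n)))
          - (\<Sum>\<^sub>\<infinity>n\<in>(UNIV::int set). q powi (3*n+1) / (1 + q powi (12*n+4)))) \<and>
    theta_phi (q^2) * theta_phi (q^3) =
       2 * ((\<Sum>\<^sub>\<infinity>n\<in>(UNIV::int set). q powi (5*n) / (1 + q powi (12*n)))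
          + (\<Sum>\<^sub>\<infinity>n\<in>(UNIV::int set). q powi (9*n+3) / (1 + q powi (12*n+4))))"
proof (cases "q = 0")
  case True
  have 0: "f summable_on A \<and> infsum f A = 0" if "\<And>n. n \<in> A \<Longrightarrow> f n = 0" for f :: "nat \<Rightarrow> complex" and A
    using that by (simp cong: summable_on_cong infsum_cong)
  note z = 0[of "{1..}" "\<lambda>n. of_int (kronecker (-6) (int n)) * (0 ^ n / (1 - 0 ^ n))", simplified]
    0[of "{1..}" "\<lambda>n. of_int (Legendre (int n) 3) * (0 ^ n * (1 - 0 ^ (2 * n)) / (1 + 0 ^ (4 * n)))", simplified]
  \<comment> \<open>Only n = 0 contributes, with denominator 1 + 0^0 = 2; hence the values 1 and
    1/2.\<close>
  have b: "(\<lambda>n. (0 powi n + 0 powi (5 * n)) / (1 + 0 powi (12 * n)) :: complex) summable_on UNIV \<and>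
      (\<Sum>\<^sub>\<infinity>n::int. (0 powi n + 0 powi (5 * n)) / (1 + 0 powi (12 * n)) :: complex) = 1"
    "(\<lambda>n. 0 powi n / (1 + 0 powi (12 * n)) :: complex) summable_on UNIV \<and>
      (\<Sum>\<^sub>\<infinity>n::int. 0 powi n / (1 + 0 powi (12 * n)) :: complex) = 1 / 2"
    "(\<lambda>n. 0 powi (5 * n) / (1 + 0 powi (12 * n)) :: complex) summable_on UNIV \<and>
      (\<Sum>\<^sub>\<infinity>n::int. 0 powi (5 * n) / (1 + 0 powi (12 * n)) :: complex) = 1 / 2"
    using infsum_single_nonzero[of "\<lambda>n. (0 powi n + 0 powi (5 * n)) / (1 + 0 powi (12 * n))"]
      infsum_single_nonzero[of "\<lambda>n. 0 powi n / (1 + 0 powi (12 * n))"]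
      infsum_single_nonzero[of "\<lambda>n. 0 powi (5 * n) / (1 + 0 powi (12 * n))"]
    by simp_all
  show ?thesis
    unfolding True using z
    by (simp add: P_quot_def Q_quot_def euler_E_0 theta_phi_0 three_n_plus_one_nonzero b)
next
  case False
  note q = assms False
  have 1: "of_int (kronecker (-6) (int n)) * (q ^ n / (1 - q ^ n)) = of_int (chi (int n)) * (q ^ n / (1 - q ^ n))"
    if "n \<in> {1..}" for n
    using that by (simp add: kronecker_minus_6)
  have 2: "of_int (Legendre (int n) 3) * (q ^ n * (1 - q ^ (2 * n)) / (1 + q ^ (4 * n))) =
      of_int (Legendre (int n) 3) * lambert_h (q ^ n)" for n
    by (simp add: lambert_h_def mult.commute flip: power_mult)
  have s: "(\<lambda>n::nat. of_int (kronecker (-6) (int n)) * (q ^ n / (1 - q ^ n))) summable_on {1..}"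
    using lambert_summable[OF assms norm_chi_le] by (subst summable_on_cong[OF 1])
  have k: "(\<Sum>\<^sub>\<infinity>n\<in>{1::nat..}. of_int (kronecker (-6) (int n)) * (q ^ n / (1 - q ^ n))) =
      (\<Sum>\<^sub>\<infinity>n\<in>{1::nat..}. of_int (chi (int n)) * (q ^ n / (1 - q ^ n)))"
    by (rule infsum_cong[OF 1])
  note sums = sum_A_plus_B[OF q] sum_C_minus_D[OF q] sum_A_minus_B[OF q]
  have AD: "P_quot q + Q_quot q = 2 * (sum_A q - sum_D q)" "P_quot q + Q_quot q = 2 * (sum_B q + sum_C q)"
    "P_quot q - Q_quot q = 2 * (sum_A q - sum_C q)" "P_quot q - Q_quot q = 2 * (sum_B q + sum_D q)"
    using sums by (auto simp: algebra_simps)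
  show ?thesis
    unfolding k 2 phi_1_6[OF q] phi_2_3[OF q]
    using lattice_sums_summable[OF q] s lambert_h_summable[OF assms] P_quot_lambert[OF q] Q_quot_lambert[OF q] AD
    unfolding sum_A_def[OF q] sum_B_def[OF q] sum_C_def[OF q] sum_D_def[OF q] has_sum_iff
    by (intro conjI) simp_all
qed

end
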